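(* Let $r \geq 2$ and $1 \leq d < r$. Then $$\mathrm{ESP}_d = \{ M \in \mathrm{mod}\,\mathcal{K}_r \mid \forall U \in \mathrm{Gr}_{d,r}\colon \mathrm{Hom}(X_U,M) = 0\},$$ $$\mathrm{CSR}_d = \{ M \in \mathrm{mod}\,\mathcal{K}_r \mid \exists c \in \mathbb{N}_0\ \forall U \in \mathrm{Gr}_{d,r}\colon \dim_k\mathrm{Hom}(X_U,M) = c\}.$$
   Context: $k$ is an algebraically closed field. $\Gamma_r$ is the quiver with vertices $1,2$ and $r$ arrows $\gamma_1,\dots,\gamma_r\colon 1 \to 2$; $\mathcal{K}_r = k\Gamma_r$ is its path algebra, with idempotents $e_1,e_2$; $\mathrm{mod}\,\mathcal{K}_r$ is the category of finite-dimensional left modules, and $M_i = e_iM$. For $\alpha \in k^r$ let $x_\alpha = \sum_i\alpha_i\gamma_i$ and let $x_\alpha^M\colon M \to M$ be multiplication by $x_\alpha$. $\mathrm{Gr}_{d,r}$ is the set of $d$-dimensional subspaces of $k^r$. For $U \in \mathrm{Gr}_{d,r}$, $\mathrm{Soc}_U(M) = \{m \in M \mid x_u^M(m) = 0 \text{ for all } u \in U\}$, which contains $M_2$. $\mathrm{CSR}_d$ is the full subcategory of modules $M$ of constant $d$-socle rank, i.e. such that $\dim_k\mathrm{Soc}_U(M)$ is independent of the choice of $U \in \mathrm{Gr}_{d,r}$. $\mathrm{ESP}_d$ is the full subcategory of modules $M$ with the equal $d$-socle property, i.e. such that $\mathrm{Soc}_U(M)$ is independent of the choice of $U \in \mathrm{Gr}_{d,r}$.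 For $U \in \mathrm{Gr}_{d,r}$ with basis $u_1,\dots,u_d$, $X_U$ is the cokernel of the homomorphism $(\mathcal{K}_re_2)^d \to \mathcal{K}_re_1$ sending $e_2$ in the $i$-th coordinate to $x_{u_i}$ (independent of the basis up to isomorphism).
   Formalization: The first equality fails for the simple module S(1) at vertex 1, which lies in ESP_d although Hom(X_U,S(1)) ≠ 0; the formal version restricts its left side to modules M in ESP_d having no direct summand isomorphic to S(1). *)

theory Defs
  imports "Jordan_Normal_Form.Missing_VectorSpace" "HOL-Algebra.Algebraic_Closure"
begin

section \<open>Left modules over a not necessarily commutative ring\<close>

text \<open>
  The locale \<^locale>\<open>module\<close> is restricted to commutative rings.  Its record type is reused here;
  as usual the fields \<open>mult\<close> and \<open>one\<close> of a module record are irrelevant, and are filled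
  arbitrarily below.
\<close>

locale left_module = R?: ring R + M?: abelian_group M
  for R :: "('a, 'b) ring_scheme" (structure) and M :: "('a, 'm, 'c) module_scheme" (structure) +
  assumes smult_closed [simp, intro]:
      "\<lbrakk>a \<in> carrier R; x \<in> carrier M\<rbrakk> \<Longrightarrow> a \<odot>\<^bsub>M\<^esub> x \<in> carrier M"
    and smult_l_distr:
      "\<lbrakk>a \<in> carrier R; b \<in> carrier R; x \<in> carrier M\<rbrakk> \<Longrightarrow>
        (a \<oplus> b) \<odot>\<^bsub>M\<^esub> x = a \<odot>\<^bsub>M\<^esub> x \<oplus>\<^bsub>M\<^esub> b \<odot>\<^bsub>M\<^esub> x"
    and smult_r_distr:
      "\<lbrakk>a \<in> carrier R; x \<in> carrier M; y \<in> carrier M\<rbrakk> \<Longrightarrow>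
        a \<odot>\<^bsub>M\<^esub> (x \<oplus>\<^bsub>M\<^esub> y) = a \<odot>\<^bsub>M\<^esub> x \<oplus>\<^bsub>M\<^esub> a \<odot>\<^bsub>M\<^esub> y"
    and smult_assoc:
      "\<lbrakk>a \<in> carrier R; b \<in> carrier R; x \<in> carrier M\<rbrakk> \<Longrightarrow>
        (a \<otimes> b) \<odot>\<^bsub>M\<^esub> x = a \<odot>\<^bsub>M\<^esub> (b \<odot>\<^bsub>M\<^esub> x)"
    and smult_one [simp]:
      "x \<in> carrier M \<Longrightarrow> \<one> \<odot>\<^bsub>M\<^esub> x = x"

definition left_submodule ::
    "('a, 'b) ring_scheme \<Rightarrow> 'm set \<Rightarrow> ('a, 'm, 'c) module_scheme \<Rightarrow> bool" where
  "left_submodule R N M \<longleftrightarrow>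
     N \<subseteq> carrier M \<and> \<zero>\<^bsub>M\<^esub> \<in> N \<and> (\<forall>x\<in>N. \<forall>y\<in>N. x \<oplus>\<^bsub>M\<^esub> y \<in> N) \<and>
     (\<forall>a\<in>carrier R. \<forall>x\<in>N. a \<odot>\<^bsub>M\<^esub> x \<in> N)"

definition module_iso ::
    "('a, 'b) ring_scheme \<Rightarrow> ('a, 'm, 'c) module_scheme \<Rightarrow> ('a, 'n, 'd) module_scheme \<Rightarrow> bool" where
  "module_iso R M N \<longleftrightarrow> (\<exists>f\<in>LinearCombinations.module_hom R M N. bij_betw f (carrier M) (carrier N))"

definition has_summand_iso_to ::
    "('a, 'b) ring_scheme \<Rightarrow> ('a, 'm, 'c) module_scheme \<Rightarrow> ('a, 'n, 'd) module_scheme \<Rightarrow> bool" where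
  "has_summand_iso_to R M S \<longleftrightarrow>
     (\<exists>N L. left_submodule R N M \<and> left_submodule R L M \<and>
            N \<inter> L = {\<zero>\<^bsub>M\<^esub>} \<and> (\<forall>m\<in>carrier M. \<exists>x\<in>N. \<exists>y\<in>L. m = x \<oplus>\<^bsub>M\<^esub> y) \<and>
            module_iso R (M\<lparr>carrier := N\<rparr>) S)"

definition regular_module :: "('a, 'b) ring_scheme \<Rightarrow> ('a, 'a) module" where
  "regular_module R =
     \<lparr>carrier = carrier R, monoid.mult = monoid.mult R, one = \<one>\<^bsub>R\<^esub>, zero = \<zero>\<^bsub>R\<^esub>, add = add R,
      smult = monoid.mult R\<rparr>"

definition cyclic_left_ideal :: "('a, 'b) ring_scheme \<Rightarrow> 'a \<Rightarrow> ('a, 'a) module" where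
  "cyclic_left_ideal R e = (regular_module R)\<lparr>carrier := (\<lambda>a. a \<otimes>\<^bsub>R\<^esub> e) ` carrier R\<rparr>"

definition module_power :: "('a, 'm, 'b) module_scheme \<Rightarrow> nat \<Rightarrow> ('a, nat \<Rightarrow> 'm) module" where
  "module_power M n =
     \<lparr>carrier = {..<n} \<rightarrow>\<^sub>E carrier M,
      monoid.mult = (\<lambda>f g. \<lambda>i\<in>{..<n}. \<zero>\<^bsub>M\<^esub>), one = (\<lambda>i\<in>{..<n}. \<zero>\<^bsub>M\<^esub>),
      zero = (\<lambda>i\<in>{..<n}. \<zero>\<^bsub>M\<^esub>),
      add = (\<lambda>f g. \<lambda>i\<in>{..<n}. f i \<oplus>\<^bsub>M\<^esub> g i),
      smult = (\<lambda>a f. \<lambda>i\<in>{..<n}. a \<odot>\<^bsub>M\<^esub> f i)\<rparr>"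

definition quotient_module :: "('a, 'm, 'b) module_scheme \<Rightarrow> 'm set \<Rightarrow> ('a, 'm set) module" where
  "quotient_module M N =
     \<lparr>carrier = a_rcosets\<^bsub>M\<^esub> N, monoid.mult = (\<lambda>C D. N), one = N, zero = N, add = set_add M,
      smult = (\<lambda>a C. \<Union>x\<in>C. N +>\<^bsub>M\<^esub> (a \<odot>\<^bsub>M\<^esub> x))\<rparr>"

definition cokernel ::
    "('a, 'm, 'b) module_scheme \<Rightarrow> ('a, 'n, 'c) module_scheme \<Rightarrow> ('m \<Rightarrow> 'n) \<Rightarrow> ('a, 'n set) module" where
  "cokernel M N f = quotient_module N (f ` carrier M)"

text \<open>
  A \<open>k\<close>-algebra \<open>A\<close> is represented by a record that carries both the ring operations and the
  scalar multiplication.  An \<open>A\<close>-module is a \<open>k\<close>-vector space along \<open>c \<mapsto> c \<cdot> 1\<close>.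
\<close>

definition restrict_scalars ::
    "('k, 'a, 'b) module_scheme \<Rightarrow> ('a, 'm, 'c) module_scheme \<Rightarrow> ('k, 'm) module" where
  "restrict_scalars A M =
     \<lparr>carrier = carrier M, monoid.mult = monoid.mult M, one = one M, zero = \<zero>\<^bsub>M\<^esub>, add = add M,
      smult = (\<lambda>c m. (c \<odot>\<^bsub>A\<^esub> \<one>\<^bsub>A\<^esub>) \<odot>\<^bsub>M\<^esub> m)\<rparr>"

text \<open>
  \<open>Hom\<close> as a \<open>k\<close>-vector space; homomorphisms are extensional so that distinct elements are
  distinct maps on the carrier.
\<close>

definition hom_space ::
    "('k, 'a, 'b) module_scheme \<Rightarrow> ('a, 'm, 'c) module_scheme \<Rightarrow> ('a, 'n, 'd) module_scheme
      \<Rightarrow> ('k, 'm \<Rightarrow> 'n) module" where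
  "hom_space A M N =
     \<lparr>carrier = LinearCombinations.module_hom A M N \<inter> extensional (carrier M),
      monoid.mult = (\<lambda>f g. \<lambda>x\<in>carrier M. \<zero>\<^bsub>N\<^esub>), one = (\<lambda>x\<in>carrier M. \<zero>\<^bsub>N\<^esub>),
      zero = (\<lambda>x\<in>carrier M. \<zero>\<^bsub>N\<^esub>),
      add = (\<lambda>f g. \<lambda>x\<in>carrier M. f x \<oplus>\<^bsub>N\<^esub> g x),
      smult = (\<lambda>c f. \<lambda>x\<in>carrier M. (c \<odot>\<^bsub>A\<^esub> \<one>\<^bsub>A\<^esub>) \<odot>\<^bsub>N\<^esub> f x)\<rparr>"

section \<open>The path algebra of the Kronecker quiver\<close>

text \<open>
  The paths of the quiver with vertices 1, 2 and arrows \<open>Arrow 0, \<dots>, Arrow (r - 1)\<close> from 1 to 2.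
  Paths are composed like functions: \<open>p q\<close> is \<open>q\<close> followed by \<open>p\<close>, so that
  \<open>\<gamma> = e\<^sub>2 \<gamma> e\<^sub>1\<close> maps \<open>e\<^sub>1 M\<close> to \<open>e\<^sub>2 M\<close> for a left module \<open>M\<close>.
\<close>

datatype kpath = Triv1 | Triv2 | Arrow nat

definition kpaths :: "nat \<Rightarrow> kpath set" where
  "kpaths r = {Triv1, Triv2} \<union> Arrow ` {..<r}"

fun path_comp :: "kpath \<Rightarrow> kpath \<Rightarrow> kpath option" where
  "path_comp Triv1 Triv1 = Some Triv1"
| "path_comp Triv2 Triv2 = Some Triv2"
| "path_comp Triv2 (Arrow i) = Some (Arrow i)"
| "path_comp (Arrow i) Triv1 = Some (Arrow i)"
| "path_comp _ _ = None"

text \<open>An element of the path algebra is the family of its coefficients with respect to the paths.\<close>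

definition kronecker_algebra :: "('k, 'b) ring_scheme \<Rightarrow> nat \<Rightarrow> ('k, kpath \<Rightarrow> 'k) module" where
  "kronecker_algebra k r =
     \<lparr>carrier = kpaths r \<rightarrow>\<^sub>E carrier k,
      monoid.mult = (\<lambda>f g. \<lambda>p\<in>kpaths r.
        \<Oplus>\<^bsub>k\<^esub>s\<in>{s \<in> kpaths r \<times> kpaths r. path_comp (fst s) (snd s) = Some p}.
          f (fst s) \<otimes>\<^bsub>k\<^esub> g (snd s)),
      one = (\<lambda>p\<in>kpaths r. if p = Triv1 \<or> p = Triv2 then \<one>\<^bsub>k\<^esub> else \<zero>\<^bsub>k\<^esub>),
      zero = (\<lambda>p\<in>kpaths r. \<zero>\<^bsub>k\<^esub>),
      add = (\<lambda>f g. \<lambda>p\<in>kpaths r. f p \<oplus>\<^bsub>k\<^esub> g p),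
      smult = (\<lambda>c f. \<lambda>p\<in>kpaths r. c \<otimes>\<^bsub>k\<^esub> f p)\<rparr>"

definition path_elem :: "('k, 'b) ring_scheme \<Rightarrow> nat \<Rightarrow> kpath \<Rightarrow> kpath \<Rightarrow> 'k" where
  "path_elem k r q = (\<lambda>p\<in>kpaths r. if p = q then \<one>\<^bsub>k\<^esub> else \<zero>\<^bsub>k\<^esub>)"

definition x_elem :: "('k, 'b) ring_scheme \<Rightarrow> nat \<Rightarrow> (nat \<Rightarrow> 'k) \<Rightarrow> kpath \<Rightarrow> 'k" where
  "x_elem k r \<alpha> =
     (\<Oplus>\<^bsub>kronecker_algebra k r\<^esub>i\<in>{..<r}. \<alpha> i \<odot>\<^bsub>kronecker_algebra k r\<^esub> path_elem k r (Arrow i))"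

definition kronecker_mod :: "('k, 'b) ring_scheme \<Rightarrow> nat \<Rightarrow> (kpath \<Rightarrow> 'k, 'm) module set" where
  "kronecker_mod k r =
     {M. left_module (kronecker_algebra k r) M \<and>
         vectorspace.fin_dim k (restrict_scalars (kronecker_algebra k r) M)}"

text \<open>
  The simple module \<open>S(1)\<close> at the vertex 1.  It is annihilated by all \<open>x\<^sub>\<alpha>\<close>, so that
  \<open>Soc\<^sub>U S(1) = S(1)\<close> for every \<open>U\<close> and \<open>S(1)\<close> has the equal \<open>d\<close>-socle property, whereas
  \<open>Hom(X\<^sub>U, S(1)) \<noteq> 0\<close>.  Characterising \<open>ESP\<close> by the vanishing of \<open>Hom(X\<^sub>U, -)\<close> therefore
  requires excluding it as a direct summand.
\<close>

definition simple1 :: "('k, 'b) ring_scheme \<Rightarrow> (kpath \<Rightarrow> 'k, 'k) module" where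
  "simple1 k =
     \<lparr>carrier = carrier k, monoid.mult = monoid.mult k, one = \<one>\<^bsub>k\<^esub>, zero = \<zero>\<^bsub>k\<^esub>, add = add k,
      smult = (\<lambda>a c. a Triv1 \<otimes>\<^bsub>k\<^esub> c)\<rparr>"

section \<open>Socles relative to subspaces of $k^r$\<close>

definition grassmannian :: "('k, 'b) ring_scheme \<Rightarrow> nat \<Rightarrow> nat \<Rightarrow> (nat \<Rightarrow> 'k) set set" where
  "grassmannian k d r =
     {U. VectorSpace.subspace k U (module_power (regular_module k) r) \<and>
         vectorspace.dim k ((module_power (regular_module k) r)\<lparr>carrier := U\<rparr>) = d}"

definition Soc ::
    "('k, 'b) ring_scheme \<Rightarrow> nat \<Rightarrow> (nat \<Rightarrow> 'k) set \<Rightarrow> (kpath \<Rightarrow> 'k, 'm) module \<Rightarrow> 'm set" where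
  "Soc k r U M = {m \<in> carrier M. \<forall>u\<in>U. x_elem k r u \<odot>\<^bsub>M\<^esub> m = \<zero>\<^bsub>M\<^esub>}"

definition CSR :: "('k, 'b) ring_scheme \<Rightarrow> nat \<Rightarrow> nat \<Rightarrow> (kpath \<Rightarrow> 'k, 'm) module set" where
  "CSR k r d =
     {M \<in> kronecker_mod k r.
       \<forall>U\<in>grassmannian k d r. \<forall>V\<in>grassmannian k d r.
         vectorspace.dim k (restrict_scalars (kronecker_algebra k r) (M\<lparr>carrier := Soc k r U M\<rparr>)) =
         vectorspace.dim k (restrict_scalars (kronecker_algebra k r) (M\<lparr>carrier := Soc k r V M\<rparr>))}"

definition ESP :: "('k, 'b) ring_scheme \<Rightarrow> nat \<Rightarrow> nat \<Rightarrow> (kpath \<Rightarrow> 'k, 'm) module set" where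
  "ESP k r d =
     {M \<in> kronecker_mod k r.
       \<forall>U\<in>grassmannian k d r. \<forall>V\<in>grassmannian k d r. Soc k r U M = Soc k r V M}"

section \<open>The modules \<open>X\<^sub>U\<close>\<close>

definition is_basis_family ::
    "('k, 'b) ring_scheme \<Rightarrow> nat \<Rightarrow> nat \<Rightarrow> (nat \<Rightarrow> 'k) set \<Rightarrow> (nat \<Rightarrow> nat \<Rightarrow> 'k) \<Rightarrow> bool" where
  "is_basis_family k r d U u \<longleftrightarrow>
     inj_on u {..<d} \<and>
     vectorspace.basis k ((module_power (regular_module k) r)\<lparr>carrier := U\<rparr>) (u ` {..<d})"

text \<open>
  A homomorphism out of \<open>(K e\<^sub>2)\<^sup>d\<close> is determined by its values on the copies of \<open>e\<^sub>2\<close>; the one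
  with \<open>e\<^sub>2 \<mapsto> x\<^sub>i\<close> in the \<open>i\<close>-th coordinate is right multiplication, since
  \<open>a = a e\<^sub>2\<close> for \<open>a \<in> K e\<^sub>2\<close> and \<open>x\<^sub>i = e\<^sub>2 x\<^sub>i\<close>.
\<close>

definition X_presentation ::
    "('k, 'b) ring_scheme \<Rightarrow> nat \<Rightarrow> nat \<Rightarrow> (nat \<Rightarrow> nat \<Rightarrow> 'k) \<Rightarrow> (nat \<Rightarrow> kpath \<Rightarrow> 'k) \<Rightarrow> kpath \<Rightarrow> 'k" where
  "X_presentation k r d u a =
     (\<Oplus>\<^bsub>kronecker_algebra k r\<^esub>i\<in>{..<d}. a i \<otimes>\<^bsub>kronecker_algebra k r\<^esub> x_elem k r (u i))"

definition X_of_family ::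
    "('k, 'b) ring_scheme \<Rightarrow> nat \<Rightarrow> nat \<Rightarrow> (nat \<Rightarrow> nat \<Rightarrow> 'k)
      \<Rightarrow> (kpath \<Rightarrow> 'k, (kpath \<Rightarrow> 'k) set) module" where
  "X_of_family k r d u =
     cokernel
       (module_power (cyclic_left_ideal (kronecker_algebra k r) (path_elem k r Triv2)) d)
       (cyclic_left_ideal (kronecker_algebra k r) (path_elem k r Triv1))
       (X_presentation k r d u)"

text \<open>The isomorphism class of \<open>X\<^sub>U\<close> does not depend on the chosen basis of \<open>U\<close>.\<close>

definition X_mod ::
    "('k, 'b) ring_scheme \<Rightarrow> nat \<Rightarrow> nat \<Rightarrow> (nat \<Rightarrow> 'k) set
      \<Rightarrow> (kpath \<Rightarrow> 'k, (kpath \<Rightarrow> 'k) set) module" where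
  "X_mod k r d U = X_of_family k r d (SOME u. is_basis_family k r d U u)"

end

theory Submission
  imports Defs
begin

text \<open>
  The module \<open>X\<^sub>U\<close> is the quotient of \<open>K e\<^sub>1\<close> by the submodule generated by the \<open>x\<^sub>u\<close> with
  \<open>u \<in> U\<close>, so evaluation at the class of \<open>e\<^sub>1\<close> identifies \<open>Hom(X\<^sub>U, M)\<close> with
  \<open>e\<^sub>1 Soc\<^sub>U(M)\<close>, and \<open>Soc\<^sub>U(M)\<close> is the direct sum of this space and \<open>M\<^sub>2\<close>.  Hence
  \<open>dim Soc\<^sub>U(M) = dim Hom(X\<^sub>U, M) + dim M\<^sub>2\<close>, which settles constant socle rank.  If \<open>Soc\<^sub>U(M)\<close> does
  not depend on \<open>U\<close>, then a nonzero element of \<open>e\<^sub>1 Soc\<^sub>U(M)\<close> is killed by \<open>x\<^sub>v\<close> for all \<open>v\<close>, because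
  every unit vector lies in some \<open>d\<close>-dimensional subspace; it therefore spans a direct summand
  isomorphic to \<open>S(1)\<close>: a complement is \<open>{m. e\<^sub>1 m \<in> W}\<close> for any hyperplane \<open>W\<close> avoiding the element.
\<close>

section \<open>Left modules\<close>

context left_module
begin

lemma smult_r_null [simp]:
  assumes "a \<in> carrier R"
  shows "a \<odot>\<^bsub>M\<^esub> \<zero>\<^bsub>M\<^esub> = \<zero>\<^bsub>M\<^esub>"
proof -
  have "a \<odot>\<^bsub>M\<^esub> \<zero>\<^bsub>M\<^esub> \<oplus>\<^bsub>M\<^esub> a \<odot>\<^bsub>M\<^esub> \<zero>\<^bsub>M\<^esub> = a \<odot>\<^bsub>M\<^esub> \<zero>\<^bsub>M\<^esub>"
    using smult_r_distr[OF assms M.zero_closed M.zero_closed] by simp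
  then show ?thesis
    using M.add.l_cancel_one[of "a \<odot>\<^bsub>M\<^esub> \<zero>\<^bsub>M\<^esub>" "a \<odot>\<^bsub>M\<^esub> \<zero>\<^bsub>M\<^esub>"] assms by simp
qed

lemma smult_l_null [simp]:
  assumes "x \<in> carrier M"
  shows "\<zero> \<odot>\<^bsub>M\<^esub> x = \<zero>\<^bsub>M\<^esub>"
proof -
  have "\<zero> \<odot>\<^bsub>M\<^esub> x \<oplus>\<^bsub>M\<^esub> \<zero> \<odot>\<^bsub>M\<^esub> x = \<zero> \<odot>\<^bsub>M\<^esub> x"
    using smult_l_distr[OF R.zero_closed R.zero_closed assms] by simp
  then show ?thesis
    using M.add.l_cancel_one[of "\<zero> \<odot>\<^bsub>M\<^esub> x" "\<zero> \<odot>\<^bsub>M\<^esub> x"] assms by simp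
qed

lemma smult_l_minus:
  assumes "a \<in> carrier R" "x \<in> carrier M"
  shows "(\<ominus> a) \<odot>\<^bsub>M\<^esub> x = \<ominus>\<^bsub>M\<^esub> (a \<odot>\<^bsub>M\<^esub> x)"
  using smult_l_distr[of "\<ominus> a" a x] assms
  by (metis M.minus_equality R.a_inv_closed R.l_neg smult_closed smult_l_null)

lemma finsum_smult_ldistr:
  assumes "finite I" "f \<in> I \<rightarrow> carrier R" "x \<in> carrier M"
  shows "(\<Oplus>i\<in>I. f i) \<odot>\<^bsub>M\<^esub> x = (\<Oplus>\<^bsub>M\<^esub>i\<in>I. f i \<odot>\<^bsub>M\<^esub> x)"
  using assms
proof (induction I rule: finite_induct)
  case (insert i I)
  then have "f \<in> I \<rightarrow> carrier R" "f i \<in> carrier R"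
    by auto
  then show ?case
    using insert by (simp add: smult_l_distr R.finsum_closed Pi_def)
qed simp

text \<open>The predicate \<open>left_submodule\<close> does not ask for negatives; they arise from
  the action of \<open>\<ominus> \<one>\<close>.\<close>

lemma left_submodule_a_inv:
  assumes "left_submodule R N M" "x \<in> N"
  shows "\<ominus>\<^bsub>M\<^esub> x \<in> N"
proof -
  have "x \<in> carrier M"
    using assms by (auto simp: left_submodule_def)
  then have "\<ominus>\<^bsub>M\<^esub> x = (\<ominus> \<one>) \<odot>\<^bsub>M\<^esub> x"
    by (simp add: smult_l_minus)
  then show ?thesis
    using assms by (simp add: left_submodule_def)
qed

text \<open>This opens the coset theory of additive groups, from which the coset lemmas below are
  derived.\<close>

lemma left_submodule_abelian_subgroup:
  assumes "left_submodule R N M"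
  shows "abelian_subgroup N M"
proof (rule abelian_subgroupI3)
  show "additive_subgroup N M"
    using assms left_submodule_a_inv[OF assms]
    by (unfold_locales) (auto simp: left_submodule_def a_inv_def)
qed (rule M.abelian_group_axioms)

section \<open>Quotient modules and principal left ideals\<close>

lemma quotient_carrier:
  "carrier (quotient_module M N) = (\<lambda>x. N +>\<^bsub>M\<^esub> x) ` carrier M"
  by (auto simp: quotient_module_def A_RCOSETS_def')

lemma quotient_add:
  assumes "left_submodule R N M" "x \<in> carrier M" "y \<in> carrier M"
  shows "(N +>\<^bsub>M\<^esub> x) \<oplus>\<^bsub>quotient_module M N\<^esub> (N +>\<^bsub>M\<^esub> y) = N +>\<^bsub>M\<^esub> (x \<oplus>\<^bsub>M\<^esub> y)"
  using abelian_subgroup.a_rcos_sum[OF left_submodule_abelian_subgroup] assms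
  by (simp add: quotient_module_def)

lemma coset_eqI:
  assumes "left_submodule R N M" "x \<in> carrier M" "y \<in> N +>\<^bsub>M\<^esub> x"
  shows "N +>\<^bsub>M\<^esub> y = N +>\<^bsub>M\<^esub> x"
  using abelian_subgroup.a_repr_independence'[OF left_submodule_abelian_subgroup[OF assms(1)] assms(3,2)]
  by simp

lemma coset_memE:
  assumes "y \<in> N +>\<^bsub>M\<^esub> x"
  obtains n where "n \<in> N" "y = n \<oplus>\<^bsub>M\<^esub> x"
  using assms by (auto simp: a_r_coset_def')

lemma coset_self:
  assumes "left_submodule R N M" "x \<in> carrier M"
  shows "x \<in> N +>\<^bsub>M\<^esub> x"
  using assms by (force simp: a_r_coset_def' left_submodule_def)

text \<open>The action on a coset is defined as a union over all representatives. Two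
  representatives differ by some \<open>n \<in> N\<close> and \<open>a n \<in> N\<close>, so all the
  cosets in the union coincide.\<close>

lemma quotient_smult:
  assumes N: "left_submodule R N M" and a: "a \<in> carrier R" and x: "x \<in> carrier M"
  shows "a \<odot>\<^bsub>quotient_module M N\<^esub> (N +>\<^bsub>M\<^esub> x) = N +>\<^bsub>M\<^esub> (a \<odot>\<^bsub>M\<^esub> x)"
proof -
  have "N +>\<^bsub>M\<^esub> (a \<odot>\<^bsub>M\<^esub> y) = N +>\<^bsub>M\<^esub> (a \<odot>\<^bsub>M\<^esub> x)" if y: "y \<in> N +>\<^bsub>M\<^esub> x" for y
  proof -
    obtain n where n: "n \<in> N" "y = n \<oplus>\<^bsub>M\<^esub> x"
      using coset_memE[OF y] by blast
    then have "n \<in> carrier M" "a \<odot>\<^bsub>M\<^esub> n \<in> N"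
      using N a by (auto simp: left_submodule_def)
    then have "a \<odot>\<^bsub>M\<^esub> y \<in> N +>\<^bsub>M\<^esub> (a \<odot>\<^bsub>M\<^esub> x)"
      using n a x by (auto simp: smult_r_distr a_r_coset_def')
    then show ?thesis
      using N a x by (intro coset_eqI) auto
  qed
  then have "(\<Union>y\<in>N +>\<^bsub>M\<^esub> x. N +>\<^bsub>M\<^esub> (a \<odot>\<^bsub>M\<^esub> y)) = N +>\<^bsub>M\<^esub> (a \<odot>\<^bsub>M\<^esub> x)"
    using coset_self[OF N x] by blast
  then show ?thesis
    by (simp add: quotient_module_def)
qed

lemma quotient_zero_coset:
  assumes "left_submodule R N M" "x \<in> N"
  shows "N +>\<^bsub>M\<^esub> x = N"
  using abelian_subgroup.a_rcos_const[OF left_submodule_abelian_subgroup] assms by simp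

end

text \<open>Sums, negatives and left multiples of right multiples of \<open>e\<close> are again
  right multiples of \<open>e\<close>. The case of interest is the pair of idempotents
  \<open>e1\<close>, \<open>e2\<close> of the path algebra.\<close>

lemma (in ring) left_module_cyclic_left_ideal:
  assumes e: "e \<in> carrier R"
  shows "left_module R (cyclic_left_ideal R e)"
proof -
  have minus: "\<exists>y\<in>carrier R. y \<otimes> e \<oplus> a \<otimes> e = \<zero>" if "a \<in> carrier R" for a
    using that e by (intro bexI[of _ "\<ominus> a"]) (auto simp flip: l_distr simp: l_neg)
  have "abelian_group (cyclic_left_ideal R e)"
  proof (rule abelian_groupI, goal_cases)
    case (1 x y)
    then show ?case
      using e by (auto simp: cyclic_left_ideal_def regular_module_def simp flip: l_distr)
  next
    case 2
    then show ?case
      using image_eqI[of \<zero> "\<lambda>a. a \<otimes> e" \<zero> "carrier R"] e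
      by (simp add: cyclic_left_ideal_def regular_module_def)
  next
    case (6 x)
    then show ?case
      using e minus by (auto simp: cyclic_left_ideal_def regular_module_def)
  qed (use e in \<open>auto simp: cyclic_left_ideal_def regular_module_def a_ac\<close>)
  moreover have "a \<otimes> x \<in> (\<lambda>a. a \<otimes> e) ` carrier R"
    if "a \<in> carrier R" "x \<in> (\<lambda>a. a \<otimes> e) ` carrier R" for a x
    using that e by (auto simp: image_iff simp flip: m_assoc)
  ultimately show ?thesis
    using e ring_axioms unfolding left_module_def
    by (auto simp: left_module_axioms_def cyclic_left_ideal_def regular_module_def
        l_distr r_distr m_assoc)
qed

section \<open>Vector spaces\<close>

text \<open>The vector space axioms pass to the image of a map that respects the operations, so the
  structure on \<open>W\<close> is a conclusion. In this way \<open>hom_space\<close> becomes a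
  vector space, as an image of a socle.\<close>

lemma (in vectorspace) linear_map_if_surj:
  assumes surj: "T ` carrier V = carrier W"
    and add: "\<And>x y. \<lbrakk>x \<in> carrier V; y \<in> carrier V\<rbrakk> \<Longrightarrow> T (x \<oplus>\<^bsub>V\<^esub> y) = T x \<oplus>\<^bsub>W\<^esub> T y"
    and smult: "\<And>c x. \<lbrakk>c \<in> carrier K; x \<in> carrier V\<rbrakk> \<Longrightarrow> T (c \<odot>\<^bsub>V\<^esub> x) = c \<odot>\<^bsub>W\<^esub> T x"
    and zero: "T \<zero>\<^bsub>V\<^esub> = \<zero>\<^bsub>W\<^esub>"
  shows "linear_map K V W T"
proof -
  \<comment> \<open>Quantifiers over \<open>W\<close> become quantifiers over \<open>V\<close>.
    Reading \<open>add\<close> and \<open>smult\<close> backwards then pulls \<open>T\<close> out of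
    both sides of each axiom.\<close>
  have all: "(\<forall>w\<in>carrier W. P w) \<longleftrightarrow> (\<forall>v\<in>carrier V. P (T v))" for P
    using surj by (metis imageE image_eqI)
  have ex: "(\<exists>w\<in>carrier W. P w) \<longleftrightarrow> (\<exists>v\<in>carrier V. P (T v))" for P
    using surj by (metis imageE image_eqI)
  have im: "v \<in> carrier V \<Longrightarrow> T v \<in> carrier W" for v
    using surj by auto
  have "vectorspace K W"
  proof (rule vs_criteria)
    show "field K" ..
    show "\<zero>\<^bsub>W\<^esub> \<in> carrier W"
      using zero im by (metis M.zero_closed)
    have "\<forall>v\<in>carrier W. \<forall>w\<in>carrier W. v \<oplus>\<^bsub>W\<^esub> w \<in> carrier W"
      unfolding all by (simp add: im flip: add)
    then show "\<forall>v w. v \<in> carrier W \<and> w \<in> carrier W \<longrightarrow> v \<oplus>\<^bsub>W\<^esub> w \<in> carrier W"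
      by blast
    show "\<forall>v\<in>carrier W. \<exists>neg_v\<in>carrier W. v \<oplus>\<^bsub>W\<^esub> neg_v = \<zero>\<^bsub>W\<^esub>"
      unfolding all ex using zero M.r_neg by (metis M.a_inv_closed add)
    have "\<forall>c\<in>carrier K. \<forall>v\<in>carrier W. c \<odot>\<^bsub>W\<^esub> v \<in> carrier W"
      unfolding all by (simp add: im flip: smult)
    then show "\<forall>c v. c \<in> carrier K \<and> v \<in> carrier W \<longrightarrow> c \<odot>\<^bsub>W\<^esub> v \<in> carrier W"
      by blast
    have "\<forall>v\<in>carrier W. \<forall>w\<in>carrier W. v \<oplus>\<^bsub>W\<^esub> w = w \<oplus>\<^bsub>W\<^esub> v"
      unfolding all by (simp add: M.a_comm flip: add)
    then show "\<forall>v w. v \<in> carrier W \<and> w \<in> carrier W \<longrightarrow> v \<oplus>\<^bsub>W\<^esub> w = w \<oplus>\<^bsub>W\<^esub> v"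
      by blast
    have "\<forall>v\<in>carrier W. \<forall>w\<in>carrier W. \<forall>x\<in>carrier W.
        v \<oplus>\<^bsub>W\<^esub> w \<oplus>\<^bsub>W\<^esub> x = v \<oplus>\<^bsub>W\<^esub> (w \<oplus>\<^bsub>W\<^esub> x)"
      unfolding all by (simp add: M.a_assoc flip: add)
    then show "\<forall>v w x. v \<in> carrier W \<and> w \<in> carrier W \<and> x \<in> carrier W \<longrightarrow>
        v \<oplus>\<^bsub>W\<^esub> w \<oplus>\<^bsub>W\<^esub> x = v \<oplus>\<^bsub>W\<^esub> (w \<oplus>\<^bsub>W\<^esub> x)"
      by blast
    show "\<forall>v\<in>carrier W. v \<oplus>\<^bsub>W\<^esub> \<zero>\<^bsub>W\<^esub> = v"
      unfolding all zero[symmetric] by (simp flip: add)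
    have "\<forall>a\<in>carrier K. \<forall>b\<in>carrier K. \<forall>v\<in>carrier W. (a \<otimes>\<^bsub>K\<^esub> b) \<odot>\<^bsub>W\<^esub> v = a \<odot>\<^bsub>W\<^esub> (b \<odot>\<^bsub>W\<^esub> v)"
      unfolding all by (simp add: smult_assoc1 flip: smult)
    then show "\<forall>a b v. a \<in> carrier K \<and> b \<in> carrier K \<and> v \<in> carrier W \<longrightarrow>
        (a \<otimes>\<^bsub>K\<^esub> b) \<odot>\<^bsub>W\<^esub> v = a \<odot>\<^bsub>W\<^esub> (b \<odot>\<^bsub>W\<^esub> v)"
      by blast
    show "\<forall>v\<in>carrier W. \<one>\<^bsub>K\<^esub> \<odot>\<^bsub>W\<^esub> v = v"
      unfolding all by (simp flip: smult)
    have "\<forall>a\<in>carrier K. \<forall>b\<in>carrier K. \<forall>v\<in>carrier W.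
        (a \<oplus>\<^bsub>K\<^esub> b) \<odot>\<^bsub>W\<^esub> v = a \<odot>\<^bsub>W\<^esub> v \<oplus>\<^bsub>W\<^esub> b \<odot>\<^bsub>W\<^esub> v"
      unfolding all by (simp add: smult_l_distr flip: add smult)
    then show "\<forall>a b v. a \<in> carrier K \<and> b \<in> carrier K \<and> v \<in> carrier W \<longrightarrow>
        (a \<oplus>\<^bsub>K\<^esub> b) \<odot>\<^bsub>W\<^esub> v = a \<odot>\<^bsub>W\<^esub> v \<oplus>\<^bsub>W\<^esub> b \<odot>\<^bsub>W\<^esub> v"
      by blast
    have "\<forall>a\<in>carrier K. \<forall>v\<in>carrier W. \<forall>w\<in>carrier W.
        a \<odot>\<^bsub>W\<^esub> (v \<oplus>\<^bsub>W\<^esub> w) = a \<odot>\<^bsub>W\<^esub> v \<oplus>\<^bsub>W\<^esub> a \<odot>\<^bsub>W\<^esub> w"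
      unfolding all by (simp add: smult_r_distr flip: add smult)
    then show "\<forall>a v w. a \<in> carrier K \<and> v \<in> carrier W \<and> w \<in> carrier W \<longrightarrow>
        a \<odot>\<^bsub>W\<^esub> (v \<oplus>\<^bsub>W\<^esub> w) = a \<odot>\<^bsub>W\<^esub> v \<oplus>\<^bsub>W\<^esub> a \<odot>\<^bsub>W\<^esub> w"
      by blast
  qed
  moreover have "T \<in> LinearCombinations.module_hom K V W"
    using im add smult by (auto simp: LinearCombinations.module_hom_def)
  ultimately show ?thesis
    using vectorspace_axioms
    by (simp add: linear_map_def mod_hom_def mod_hom_axioms_def vectorspace_def)
qed

section \<open>Subspaces and complements in finite dimension\<close>

text \<open>Independent subsets of \<open>W\<close> stay independent in \<open>V\<close>, which
  bounds their size by \<open>dim\<close>. A maximal one therefore exists, and it generates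
  \<open>W\<close>.\<close>

lemma (in vectorspace) fin_dim_subspace:
  assumes "fin_dim" "VectorSpace.subspace K W V"
  shows "vectorspace.fin_dim K (vs W)"
proof -
  interpret W: vectorspace K "vs W"
    by (rule subspace_is_vs[OF assms(2)])
  have W: "submodule K W V"
    using assms(2) by (auto simp: subspace_def)
  then have WV: "W \<subseteq> carrier V"
    by (simp add: submodule_def)
  let ?P = "\<lambda>S. S \<subseteq> carrier (vs W) \<and> W.module.lin_indpt S"
  have bound: "finite S \<and> card S \<le> dim" if "?P S" for S
    using that WV li_le_dim[OF assms(1), of S] span_li_not_depend(2)[of S W] W by auto
  have "?P {}"
    by (simp add: W.module.lin_dep_def)
  from maximal_exists[of ?P, OF bound this] obtain B where "finite B" "maximal B ?P"
    by blast
  then show ?thesis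
    using W.max_li_is_gen[of B] unfolding W.fin_dim_def maximal_def by blast
qed

text \<open>Steinitz exchange extends \<open>n\<close> to a basis; the remaining basis vectors span
  a hyperplane complementary to the line through \<open>n\<close>.\<close>

lemma (in vectorspace) line_complement:
  assumes fd: "fin_dim" and n: "n \<in> carrier V" "n \<noteq> \<zero>\<^bsub>V\<^esub>"
  obtains W where "VectorSpace.subspace K W V" "n \<notin> W"
    "\<And>v. v \<in> carrier V \<Longrightarrow> \<exists>c\<in>carrier K. \<exists>w\<in>W. v = c \<odot>\<^bsub>V\<^esub> n \<oplus>\<^bsub>V\<^esub> w"
proof -
  obtain B where B: "finite B" "basis B"
    using finite_basis_exists[OF fd] by blast
  have li: "lin_indpt {n}"
    using lindep_span[of "{n}"] n by (simp add: span_empty)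
  obtain C where C: "finite C" "C \<subseteq> carrier V" "C \<inter> {n} = {}"
    "int (card C) \<le> int (card B) - int (card {n})" "span ({n} \<union> C) = span B"
    using replacement[of "{n}" B] B n li unfolding basis_def by auto
  have "span ({n} \<union> C) = carrier V"
    using B C by (simp add: basis_def)
  \<comment> \<open>A generating set with at most \<open>dim\<close> elements is a basis; this is
    what separates \<open>n\<close> from the span of \<open>C\<close>.\<close>
  moreover have "card ({n} \<union> C) \<le> dim"
    using C dim_basis[OF B] by simp
  ultimately have "basis ({n} \<union> C)"
    using C n by (intro dim_gen_is_basis) auto
  then have "lin_indpt ({n} \<union> C)"
    by (simp add: basis_def)
  then have "n \<notin> span ({n} \<union> C - {n})"
    using lindep_span[of "{n} \<union> C"] C n by auto
  moreover have "{n} \<union> C - {n} = C"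
    using C by auto
  moreover have "\<exists>c\<in>carrier K. \<exists>w\<in>span C. v = c \<odot>\<^bsub>V\<^esub> n \<oplus>\<^bsub>V\<^esub> w" if v: "v \<in> carrier V" for v
  proof -
    obtain a where a: "a \<in> {n} \<union> C \<rightarrow> carrier K" "lincomb a ({n} \<union> C) = v"
      using finite_in_span[of "{n} \<union> C" v] v C(1,2) n \<open>span ({n} \<union> C) = carrier V\<close>
      by (metis finite.emptyI finite.insertI finite_UnI Un_least empty_subsetI insert_subset)
    then have "v = a n \<odot>\<^bsub>V\<^esub> n \<oplus>\<^bsub>V\<^esub> lincomb a C"
      using lincomb_insert[of C a n] C n by (simp add: Un_commute)
    moreover have "lincomb a C \<in> span C"
      using a C by (auto simp: span_def)
    ultimately show ?thesis
      using a by auto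
  qed
  ultimately show ?thesis
    using that[of "span C"] span_is_subspace[OF C(2)] by auto
qed

section \<open>Coordinate spaces and Grassmannians\<close>

abbreviation coordinate_space :: "('k, 'b) ring_scheme \<Rightarrow> nat \<Rightarrow> ('k, nat \<Rightarrow> 'k) module" where
  "coordinate_space k r \<equiv> module_power (regular_module k) r"

definition unit_vector :: "('k, 'b) ring_scheme \<Rightarrow> nat \<Rightarrow> nat \<Rightarrow> nat \<Rightarrow> 'k" where
  "unit_vector k r j = (\<lambda>i\<in>{..<r}. if i = j then \<one>\<^bsub>k\<^esub> else \<zero>\<^bsub>k\<^esub>)"

text \<open>The spans of unit vectors supply every explicit subspace used below: points of the
  Grassmannian through a given unit vector, the point witnessing that it is nonempty, and the whole
  space for \<open>J = {..<r}\<close>.\<close>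

definition coordinate_subspace :: "('k, 'b) ring_scheme \<Rightarrow> nat \<Rightarrow> nat set \<Rightarrow> (nat \<Rightarrow> 'k) set" where
  "coordinate_subspace k r J = {v \<in> {..<r} \<rightarrow>\<^sub>E carrier k. \<forall>i<r. i \<notin> J \<longrightarrow> v i = \<zero>\<^bsub>k\<^esub>}"

lemma coordinate_space_simps [simp]:
  "carrier (coordinate_space k r) = {..<r} \<rightarrow>\<^sub>E carrier k"
  "\<zero>\<^bsub>coordinate_space k r\<^esub> = (\<lambda>i\<in>{..<r}. \<zero>\<^bsub>k\<^esub>)"
  "v \<oplus>\<^bsub>coordinate_space k r\<^esub> w = (\<lambda>i\<in>{..<r}. v i \<oplus>\<^bsub>k\<^esub> w i)"
  "c \<odot>\<^bsub>coordinate_space k r\<^esub> v = (\<lambda>i\<in>{..<r}. c \<otimes>\<^bsub>k\<^esub> v i)"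
  by (simp_all add: module_power_def regular_module_def)

context field
begin

lemma coordinate_space_vectorspace: "vectorspace R (coordinate_space R r)"
proof (rule vs_criteria, goal_cases)
  case 4
  have "(\<lambda>i\<in>{..<r}. \<ominus> v i) \<in> carrier (coordinate_space R r) \<and>
      v \<oplus>\<^bsub>coordinate_space R r\<^esub> (\<lambda>i\<in>{..<r}. \<ominus> v i) = \<zero>\<^bsub>coordinate_space R r\<^esub>"
    if "v \<in> carrier (coordinate_space R r)" for v
    using that by (auto simp: fun_eq_iff PiE_iff r_neg)
  then show ?case
    by blast
qed (auto simp: fun_eq_iff PiE_iff field_axioms a_ac m_assoc l_distr r_distr extensional_def)

lemma coordinate_subspace_subspace:
  "VectorSpace.subspace R (coordinate_subspace R r J) (coordinate_space R r)"
proof -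
  have "Module.module R (coordinate_space R r)"
    using coordinate_space_vectorspace[of r] by (simp add: vectorspace_def)
  then have "submodule R (coordinate_subspace R r J) (coordinate_space R r)"
    unfolding submodule_def by (auto simp: coordinate_subspace_def PiE_mem)
  then show ?thesis
    by (simp add: VectorSpace.subspace_def coordinate_space_vectorspace)
qed

lemma unit_vector_mem: "j \<in> J \<Longrightarrow> unit_vector R r j \<in> coordinate_subspace R r J"
  by (auto simp: coordinate_subspace_def unit_vector_def)

lemma unit_vector_carrier: "unit_vector R r j \<in> {..<r} \<rightarrow>\<^sub>E carrier R"
  by (auto simp: unit_vector_def)

lemma unit_vector_eq_iff:
  assumes "i < r"
  shows "unit_vector R r i = unit_vector R r j \<longleftrightarrow> i = j"
  using assms by (auto simp: unit_vector_def fun_eq_iff restrict_def split: if_splits)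

text \<open>Linear combinations in a subspace are sums in the record with restricted carrier;
  evaluating them coordinatewise reduces them to sums in the field.\<close>

lemma finsum_coordinate_subspace:
  assumes "finite I" "f \<in> I \<rightarrow> coordinate_subspace R r J" "i < r"
  shows "finsum ((coordinate_space R r)\<lparr>carrier := coordinate_subspace R r J\<rparr>) f I i =
    (\<Oplus>x\<in>I. f x i)"
proof -
  interpret W: vectorspace R "(coordinate_space R r)\<lparr>carrier := coordinate_subspace R r J\<rparr>"
    using vectorspace.subspace_is_vs[OF coordinate_space_vectorspace coordinate_subspace_subspace] .
  show ?thesis
    using assms
  proof (induction I rule: finite_induct)
    case (insert x I)
    then have "f x \<in> coordinate_subspace R r J" "f \<in> I \<rightarrow> coordinate_subspace R r J"
      by auto
    moreover from this have "f x i \<in> carrier R" "(\<lambda>x. f x i) \<in> I \<rightarrow> carrier R"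
      using \<open>i < r\<close> by (auto simp: coordinate_subspace_def Pi_iff PiE_iff)
    ultimately show ?case
      using insert by (subst W.finsum_insert) (simp_all add: finsum_insert)
  qed simp
qed

text \<open>The coefficient of a unit vector in a linear combination is the corresponding
  coordinate. Every vector thus has exactly one expansion, which is the criterion for a
  basis.\<close>

lemma coordinate_subspace_basis:
  assumes J: "J \<subseteq> {..<r}"
  shows "vectorspace.basis R ((coordinate_space R r)\<lparr>carrier := coordinate_subspace R r J\<rparr>)
    (unit_vector R r ` J)"
proof -
  let ?e = "unit_vector R r" and ?U = "coordinate_subspace R r J"
  let ?W = "(coordinate_space R r)\<lparr>carrier := ?U\<rparr>"
  interpret W: vectorspace R ?W
    using vectorspace.subspace_is_vs[OF coordinate_space_vectorspace coordinate_subspace_subspace] .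
  have fin: "finite (?e ` J)"
    using J finite_subset by auto
  have sub: "?e ` J \<subseteq> carrier ?W"
    by (auto simp: unit_vector_mem)
  have inj: "inj_on ?e J"
    using J by (auto simp: inj_on_def unit_vector_eq_iff)
  have lincomb: "W.module.lincomb a (?e ` J) i = a (?e i)"
    if a: "a \<in> ?e ` J \<rightarrow> carrier R" and i: "i \<in> J" for a i
  proof -
    have "(\<lambda>v. a v \<odot>\<^bsub>?W\<^esub> v) \<in> ?e ` J \<rightarrow> ?U"
      using W.module.summands_valid[OF sub a] by (simp add: Pi_iff)
    then have "W.module.lincomb a (?e ` J) i = (\<Oplus>v\<in>?e ` J. (a v \<odot>\<^bsub>?W\<^esub> v) i)"
      using i J finsum_coordinate_subspace[OF fin] by (auto simp: W.module.lincomb_def)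
    \<comment> \<open>Only the \<open>i\<close>-th unit vector has a nonzero coordinate at
      \<open>i\<close>.\<close>
    also have "\<dots> = (\<Oplus>v\<in>?e ` J. if ?e i = v then a v else \<zero>)"
    proof (rule finsum_cong')
      show "(\<lambda>v. if ?e i = v then a v else \<zero>) \<in> ?e ` J \<rightarrow> carrier R"
        using a by auto
      show "(a v \<odot>\<^bsub>?W\<^esub> v) i = (if ?e i = v then a v else \<zero>)" if v: "v \<in> ?e ` J" for v
      proof -
        obtain j where j: "j \<in> J" "v = ?e j"
          using v by blast
        have "i < r" "a v \<in> carrier R"
          using i J a v by auto
        then show ?thesis
          using unit_vector_eq_iff[of i r j] unfolding j(2) by (auto simp: unit_vector_def)
      qed
    qed simp
    also have "\<dots> = a (?e i)"
      using finsum_singleton[of "?e i" "?e ` J" a] a i fin by auto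
    finally show ?thesis .
  qed
  \<comment> \<open>Both sides vanish at the indices outside \<open>J\<close>, so equality needs to
    be tested on \<open>J\<close> only.\<close>
  have lincomb_eq: "W.module.lincomb a (?e ` J) = v \<longleftrightarrow> (\<forall>i\<in>J. a (?e i) = v i)"
    if a: "a \<in> ?e ` J \<rightarrow> carrier R" and v: "v \<in> ?U" for a v
  proof -
    have "W.module.lincomb a (?e ` J) \<in> ?U"
      using W.module.lincomb_closed[OF sub a] by simp
    then have "W.module.lincomb a (?e ` J) = v \<longleftrightarrow> (\<forall>i\<in>J. W.module.lincomb a (?e ` J) i = v i)"
      using v J
      by (auto simp: coordinate_subspace_def intro!: PiE_ext[of _ "{..<r}" "\<lambda>_. carrier R"])
    then show ?thesis
      using lincomb a by simp
  qed
  have "\<exists>!a. a \<in> ?e ` J \<rightarrow>\<^sub>E carrier R \<and> W.module.lincomb a (?e ` J) = v" if v: "v \<in> ?U" for v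
  proof (rule ex1I)
    \<comment> \<open>The inverse of the injective family \<open>?e\<close> recovers the index, so
      the coefficient at \<open>?e i\<close> is the coordinate \<open>v i\<close>.\<close>
    define a where "a = (\<lambda>x\<in>?e ` J. v (the_inv_into J ?e x))"
    have ae: "a (?e i) = v i" if "i \<in> J" for i
      using that by (simp add: a_def the_inv_into_f_f[OF inj])
    have vi: "v i \<in> carrier R" if "i \<in> J" for i
      using that v J by (auto simp: coordinate_subspace_def)
    have a: "a \<in> ?e ` J \<rightarrow> carrier R"
      using ae vi by auto
    then have "W.module.lincomb a (?e ` J) = v"
      using lincomb_eq[OF a v] ae by blast
    moreover have "a \<in> ?e ` J \<rightarrow>\<^sub>E carrier R"
      using a by (simp add: PiE_def a_def)
    ultimately show "a \<in> ?e ` J \<rightarrow>\<^sub>E carrier R \<and> W.module.lincomb a (?e ` J) = v"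
      by blast
    show "b = a" if b: "b \<in> ?e ` J \<rightarrow>\<^sub>E carrier R \<and> W.module.lincomb b (?e ` J) = v" for b
    proof (rule extensionalityI)
      show "b \<in> extensional (?e ` J)" "a \<in> extensional (?e ` J)"
        using b by (simp_all add: PiE_def a_def)
      have "b \<in> ?e ` J \<rightarrow> carrier R"
        using b by (simp add: PiE_def)
      then have "\<forall>i\<in>J. b (?e i) = v i"
        using lincomb_eq[OF _ v] b by blast
      then show "b x = a x" if "x \<in> ?e ` J" for x
        using that ae by auto
    qed
  qed
  then show ?thesis
    using W.basis_criterion[OF fin sub] by simp
qed

section \<open>Points of the Grassmannian and their bases\<close>

lemma coordinate_subspace_grassmannian:
  assumes "J \<subseteq> {..<r}"
  shows "coordinate_subspace R r J \<in> grassmannian R (card J) r"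
proof -
  let ?W = "(coordinate_space R r)\<lparr>carrier := coordinate_subspace R r J\<rparr>"
  have "inj_on (unit_vector R r) J"
    using assms by (auto simp: inj_on_def unit_vector_eq_iff)
  moreover have "finite J"
    using assms finite_subset by auto
  moreover have "vectorspace R ?W"
    using vectorspace.subspace_is_vs[OF coordinate_space_vectorspace coordinate_subspace_subspace] .
  ultimately have "vectorspace.dim R ?W = card J"
    using vectorspace.dim_basis[OF _ _ coordinate_subspace_basis[OF assms]]
    by (simp add: card_image)
  then show ?thesis
    by (simp add: grassmannian_def coordinate_subspace_subspace)
qed

text \<open>Complete \<open>i\<close> by \<open>d - 1\<close> other indices, which is where
  \<open>1 \<le> d\<close> and \<open>d \<le> r\<close> enter, and take the coordinate
  subspace.\<close>

lemma unit_vector_in_grassmannian: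
  assumes "i < r" "1 \<le> d" "d \<le> r"
  obtains U where "U \<in> grassmannian R d r" "unit_vector R r i \<in> U"
proof -
  have d: "d - 1 \<le> card ({..<r} - {i})"
    using assms by simp
  obtain J where "J \<subseteq> {..<r} - {i}" "card J = d - 1"
    using obtain_subset_with_card_n[of "d - 1" "{..<r} - {i}"] d by blast
  moreover from this have "finite J"
    using finite_subset by auto
  ultimately have "insert i J \<subseteq> {..<r}" "card (insert i J) = d"
    using assms by (auto simp: card_insert_if)
  then show ?thesis
    using that coordinate_subspace_grassmannian[of "insert i J" r]
      unit_vector_mem[of i "insert i J" r] by auto
qed

lemma coordinate_space_fin_dim: "vectorspace.fin_dim R (coordinate_space R r)"
proof -
  interpret V: vectorspace R "coordinate_space R r"
    by (rule coordinate_space_vectorspace)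
  have "(coordinate_space R r)\<lparr>carrier := coordinate_subspace R r {..<r}\<rparr> = coordinate_space R r"
    by (simp add: coordinate_subspace_def module_power_def regular_module_def)
  then have "V.basis (unit_vector R r ` {..<r})"
    using coordinate_subspace_basis[of "{..<r}" r] by simp
  then show ?thesis
    by (auto simp: V.fin_dim_def V.basis_def)
qed

text \<open>This guarantees that the choice operator in \<open>X_mod\<close> really picks a
  basis.\<close>

lemma grassmannian_basis_family:
  assumes "U \<in> grassmannian R d r"
  obtains u where "is_basis_family R r d U u"
proof -
  let ?W = "(coordinate_space R r)\<lparr>carrier := U\<rparr>"
  have U: "VectorSpace.subspace R U (coordinate_space R r)" "vectorspace.dim R ?W = d"
    using assms by (auto simp: grassmannian_def)
  interpret W: vectorspace R ?W
    using vectorspace.subspace_is_vs[OF coordinate_space_vectorspace U(1)] .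
  obtain B where B: "finite B" "W.basis B"
    using W.finite_basis_exists vectorspace.fin_dim_subspace[OF coordinate_space_vectorspace
        coordinate_space_fin_dim U(1)] by blast
  then have "card B = d"
    using W.dim_basis U(2) by simp
  then obtain u where "bij_betw u {..<d} B"
    using ex_bij_betw_nat_finite[OF B(1)] by (auto simp: atLeast0LessThan)
  then show ?thesis
    using that B by (auto simp: is_basis_family_def bij_betw_def)
qed

end

section \<open>Modules over the Kronecker algebra\<close>

text \<open>The factorizations of a path are the index set of the sum that defines its coefficient
  in a product.\<close>

lemma path_comp_eq_Some_iff:
  "path_comp p q = Some Triv1 \<longleftrightarrow> p = Triv1 \<and> q = Triv1"
  "path_comp p q = Some Triv2 \<longleftrightarrow> p = Triv2 \<and> q = Triv2"
  "path_comp p q = Some (Arrow i) \<longleftrightarrow> p = Triv2 \<and> q = Arrow i \<or> p = Arrow i \<and> q = Triv1"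
  by (cases p; cases q; auto)+

lemma kpaths_mem [simp]:
  "Triv1 \<in> kpaths r" "Triv2 \<in> kpaths r" "Arrow i \<in> kpaths r \<longleftrightarrow> i < r"
  by (auto simp: kpaths_def)

lemma kpaths_cases:
  assumes "p \<in> kpaths r"
  obtains "p = Triv1" | "p = Triv2" | i where "i < r" "p = Arrow i"
  using assms by (auto simp: kpaths_def)

lemma kronecker_algebra_carrier:
  "carrier (kronecker_algebra k r) = kpaths r \<rightarrow>\<^sub>E carrier k"
  by (simp add: kronecker_algebra_def)

lemma kronecker_algebra_zero_apply [simp]:
  "p \<in> kpaths r \<Longrightarrow> \<zero>\<^bsub>kronecker_algebra k r\<^esub> p = \<zero>\<^bsub>k\<^esub>"
  by (simp add: kronecker_algebra_def)

lemma kronecker_algebra_add_apply [simp]: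
  "p \<in> kpaths r \<Longrightarrow> (a \<oplus>\<^bsub>kronecker_algebra k r\<^esub> b) p = a p \<oplus>\<^bsub>k\<^esub> b p"
  by (simp add: kronecker_algebra_def)

lemma kronecker_algebra_smult_apply [simp]:
  "p \<in> kpaths r \<Longrightarrow> (c \<odot>\<^bsub>kronecker_algebra k r\<^esub> a) p = c \<otimes>\<^bsub>k\<^esub> a p"
  by (simp add: kronecker_algebra_def)

lemma kronecker_algebra_one_apply [simp]:
  "\<one>\<^bsub>kronecker_algebra k r\<^esub> Triv1 = \<one>\<^bsub>k\<^esub>"
  "\<one>\<^bsub>kronecker_algebra k r\<^esub> Triv2 = \<one>\<^bsub>k\<^esub>"
  "i < r \<Longrightarrow> \<one>\<^bsub>kronecker_algebra k r\<^esub> (Arrow i) = \<zero>\<^bsub>k\<^esub>"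
  by (simp_all add: kronecker_algebra_def)

lemma path_elem_apply [simp]:
  "p \<in> kpaths r \<Longrightarrow> path_elem k r q p = (if p = q then \<one>\<^bsub>k\<^esub> else \<zero>\<^bsub>k\<^esub>)"
  by (simp add: path_elem_def)

text \<open>Comparing coefficients on the three kinds of paths turns the identities in the algebra
  into computations in \<open>k\<close>.\<close>

lemma kronecker_algebra_eqI:
  assumes "a \<in> carrier (kronecker_algebra k r)" "b \<in> carrier (kronecker_algebra k r)"
    and "a Triv1 = b Triv1" "a Triv2 = b Triv2" "\<And>i. i < r \<Longrightarrow> a (Arrow i) = b (Arrow i)"
  shows "a = b"
  using assms
  by (auto simp: kronecker_algebra_carrier elim: kpaths_cases
      intro!: PiE_ext[of a "kpaths r" "\<lambda>_. carrier k"])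

text \<open>That \<open>kronecker_algebra k r\<close> is a ring is part of
  \<open>left_module\<close>, so it comes with \<open>M\<close>. Finite dimension is kept as a
  separate premise of the lemmas that use it.\<close>

locale kronecker_module = K: field k + left_module "kronecker_algebra k r" M
  for k :: "('k, 'b) ring_scheme" and r :: nat and M :: "(kpath \<Rightarrow> 'k, 'm) module"
begin

abbreviation "A \<equiv> kronecker_algebra k r"
abbreviation "e1 \<equiv> path_elem k r Triv1"
abbreviation "e2 \<equiv> path_elem k r Triv2"
abbreviation "scalar c \<equiv> c \<odot>\<^bsub>A\<^esub> \<one>\<^bsub>A\<^esub>"
abbreviation "xe \<equiv> x_elem k r"

lemma apply_closed [simp]: "\<lbrakk>a \<in> carrier A; p \<in> kpaths r\<rbrakk> \<Longrightarrow> a p \<in> carrier k"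
  by (auto simp: kronecker_algebra_carrier)

lemma smult_algebra_closed [simp]:
  "\<lbrakk>c \<in> carrier k; a \<in> carrier A\<rbrakk> \<Longrightarrow> c \<odot>\<^bsub>A\<^esub> a \<in> carrier A"
  by (auto simp: kronecker_algebra_def)

lemma path_elem_closed [simp]: "path_elem k r q \<in> carrier A"
  by (auto simp: kronecker_algebra_carrier path_elem_def)

text \<open>A trivial path factors only as its own square, whereas an arrow factors twice: through
  \<open>Triv2\<close> on the left and through \<open>Triv1\<close> on the right.\<close>

lemma mult_apply [simp]:
  assumes "a \<in> carrier A" "b \<in> carrier A"
  shows "(a \<otimes>\<^bsub>A\<^esub> b) Triv1 = a Triv1 \<otimes>\<^bsub>k\<^esub> b Triv1"
    and "(a \<otimes>\<^bsub>A\<^esub> b) Triv2 = a Triv2 \<otimes>\<^bsub>k\<^esub> b Triv2"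
    and "i < r \<Longrightarrow> (a \<otimes>\<^bsub>A\<^esub> b) (Arrow i) =
      a Triv2 \<otimes>\<^bsub>k\<^esub> b (Arrow i) \<oplus>\<^bsub>k\<^esub> a (Arrow i) \<otimes>\<^bsub>k\<^esub> b Triv1"
proof -
  have "{s \<in> kpaths r \<times> kpaths r. path_comp (fst s) (snd s) = Some Triv1} = {(Triv1, Triv1)}"
    by (auto simp: path_comp_eq_Some_iff)
  then show "(a \<otimes>\<^bsub>A\<^esub> b) Triv1 = a Triv1 \<otimes>\<^bsub>k\<^esub> b Triv1"
    using assms by (simp add: kronecker_algebra_def[of k r] PiE_iff)
  have "{s \<in> kpaths r \<times> kpaths r. path_comp (fst s) (snd s) = Some Triv2} = {(Triv2, Triv2)}"
    by (auto simp: path_comp_eq_Some_iff)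
  then show "(a \<otimes>\<^bsub>A\<^esub> b) Triv2 = a Triv2 \<otimes>\<^bsub>k\<^esub> b Triv2"
    using assms by (simp add: kronecker_algebra_def[of k r] PiE_iff)
  show "(a \<otimes>\<^bsub>A\<^esub> b) (Arrow i) =
      a Triv2 \<otimes>\<^bsub>k\<^esub> b (Arrow i) \<oplus>\<^bsub>k\<^esub> a (Arrow i) \<otimes>\<^bsub>k\<^esub> b Triv1" if "i < r"
  proof -
    have "{s \<in> kpaths r \<times> kpaths r. path_comp (fst s) (snd s) = Some (Arrow i)} =
        {(Triv2, Arrow i), (Arrow i, Triv1)}"
      using that by (auto simp: path_comp_eq_Some_iff)
    then show ?thesis
      using assms that by (simp add: kronecker_algebra_def[of k r] PiE_iff)
  qed
qed

lemma finsum_algebra_apply: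
  assumes "finite I" "f \<in> I \<rightarrow> carrier A" "p \<in> kpaths r"
  shows "(\<Oplus>\<^bsub>A\<^esub>i\<in>I. f i) p = (\<Oplus>\<^bsub>k\<^esub>i\<in>I. f i p)"
  using assms
proof (induction I rule: finite_induct)
  case (insert i I)
  then have "f i \<in> carrier A" "f \<in> I \<rightarrow> carrier A"
    by auto
  moreover from this have "(\<lambda>i. f i p) \<in> I \<rightarrow> carrier k"
    using \<open>p \<in> kpaths r\<close> by (auto simp: Pi_iff)
  ultimately show ?case
    using insert by (simp add: R.finsum_insert K.finsum_insert)
qed simp

lemma x_closed [simp]:
  assumes "\<alpha> \<in> {..<r} \<rightarrow>\<^sub>E carrier k"
  shows "xe \<alpha> \<in> carrier A"
  using assms by (auto simp: x_elem_def PiE_iff intro!: R.finsum_closed)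

lemma x_apply [simp]:
  assumes "\<alpha> \<in> {..<r} \<rightarrow>\<^sub>E carrier k"
  shows "xe \<alpha> Triv1 = \<zero>\<^bsub>k\<^esub>" "xe \<alpha> Triv2 = \<zero>\<^bsub>k\<^esub>" "i < r \<Longrightarrow> xe \<alpha> (Arrow i) = \<alpha> i"
proof -
  have f: "(\<lambda>i. \<alpha> i \<odot>\<^bsub>A\<^esub> path_elem k r (Arrow i)) \<in> {..<r} \<rightarrow> carrier A"
    using assms by (auto simp: PiE_iff)
  have xe: "xe \<alpha> p = (\<Oplus>\<^bsub>k\<^esub>j\<in>{..<r}. \<alpha> j \<otimes>\<^bsub>k\<^esub> (if p = Arrow j then \<one>\<^bsub>k\<^esub> else \<zero>\<^bsub>k\<^esub>))"
    if "p \<in> kpaths r" for p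
    using finsum_algebra_apply[OF _ f that] that by (simp add: x_elem_def)
  have "(\<Oplus>\<^bsub>k\<^esub>j\<in>{..<r}. \<alpha> j \<otimes>\<^bsub>k\<^esub> \<zero>\<^bsub>k\<^esub>) = (\<Oplus>\<^bsub>k\<^esub>j\<in>{..<r}. \<zero>\<^bsub>k\<^esub>)"
    using assms by (intro K.finsum_cong') (auto simp: PiE_iff)
  then show "xe \<alpha> Triv1 = \<zero>\<^bsub>k\<^esub>" "xe \<alpha> Triv2 = \<zero>\<^bsub>k\<^esub>"
    using xe by simp_all
  assume i: "i < r"
  have "(\<Oplus>\<^bsub>k\<^esub>j\<in>{..<r}. \<alpha> j \<otimes>\<^bsub>k\<^esub> (if Arrow i = Arrow j then \<one>\<^bsub>k\<^esub> else \<zero>\<^bsub>k\<^esub>)) =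
      (\<Oplus>\<^bsub>k\<^esub>j\<in>{..<r}. if i = j then \<alpha> j else \<zero>\<^bsub>k\<^esub>)"
    using assms by (intro K.finsum_cong') (auto simp: PiE_iff)
  also have "\<dots> = \<alpha> i"
    using i assms by (intro K.finsum_singleton) auto
  finally show "xe \<alpha> (Arrow i) = \<alpha> i"
    using xe i by simp
qed

section \<open>Scalars, idempotents and the elements \<open>xe \<alpha>\<close> of the path
  algebra\<close>

lemma scalar_mult_left: "\<lbrakk>c \<in> carrier k; a \<in> carrier A\<rbrakk> \<Longrightarrow> scalar c \<otimes>\<^bsub>A\<^esub> a = c \<odot>\<^bsub>A\<^esub> a"
  by (rule kronecker_algebra_eqI) auto

lemma scalar_mult_right: "\<lbrakk>c \<in> carrier k; a \<in> carrier A\<rbrakk> \<Longrightarrow> a \<otimes>\<^bsub>A\<^esub> scalar c = c \<odot>\<^bsub>A\<^esub> a"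
  by (rule kronecker_algebra_eqI) (auto simp: K.m_comm)

lemma scalar_add:
  "\<lbrakk>c \<in> carrier k; d \<in> carrier k\<rbrakk> \<Longrightarrow> scalar (c \<oplus>\<^bsub>k\<^esub> d) = scalar c \<oplus>\<^bsub>A\<^esub> scalar d"
  by (rule kronecker_algebra_eqI) auto

lemma scalar_mult:
  "\<lbrakk>c \<in> carrier k; d \<in> carrier k\<rbrakk> \<Longrightarrow> scalar (c \<otimes>\<^bsub>k\<^esub> d) = scalar c \<otimes>\<^bsub>A\<^esub> scalar d"
  by (rule kronecker_algebra_eqI) auto

lemma scalar_one: "scalar \<one>\<^bsub>k\<^esub> = \<one>\<^bsub>A\<^esub>"
  by (rule kronecker_algebra_eqI) auto

lemma scalar_zero: "scalar \<zero>\<^bsub>k\<^esub> = \<zero>\<^bsub>A\<^esub>"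
  by (rule kronecker_algebra_eqI) auto

text \<open>No arrow ends at the vertex 1, so multiplying by \<open>e1\<close> on the left keeps
  only the coefficient of \<open>Triv1\<close>.\<close>

lemma e1_mult: "a \<in> carrier A \<Longrightarrow> e1 \<otimes>\<^bsub>A\<^esub> a = scalar (a Triv1) \<otimes>\<^bsub>A\<^esub> e1"
  by (rule kronecker_algebra_eqI) auto

lemma e1_idem: "e1 \<otimes>\<^bsub>A\<^esub> e1 = e1"
  by (rule kronecker_algebra_eqI) auto

lemma x_mult_e1: "\<alpha> \<in> {..<r} \<rightarrow>\<^sub>E carrier k \<Longrightarrow> xe \<alpha> \<otimes>\<^bsub>A\<^esub> e1 = xe \<alpha>"
  by (rule kronecker_algebra_eqI) (auto simp: PiE_iff)

lemma e2_mult_x: "\<alpha> \<in> {..<r} \<rightarrow>\<^sub>E carrier k \<Longrightarrow> e2 \<otimes>\<^bsub>A\<^esub> xe \<alpha> = xe \<alpha>"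
  by (rule kronecker_algebra_eqI) (auto simp: PiE_iff)

text \<open>The paths starting at the vertex 1 are \<open>Triv1\<close> and the arrows, and a
  combination of arrows is some \<open>xe \<alpha>\<close>.\<close>

lemma mult_e1_decomp:
  "a \<in> carrier A \<Longrightarrow> a \<otimes>\<^bsub>A\<^esub> e1 = scalar (a Triv1) \<otimes>\<^bsub>A\<^esub> e1 \<oplus>\<^bsub>A\<^esub> xe (\<lambda>i\<in>{..<r}. a (Arrow i))"
  by (rule kronecker_algebra_eqI) auto

lemma x_add:
  "\<lbrakk>\<alpha> \<in> {..<r} \<rightarrow>\<^sub>E carrier k; \<beta> \<in> {..<r} \<rightarrow>\<^sub>E carrier k\<rbrakk> \<Longrightarrow>
    xe (\<lambda>i\<in>{..<r}. \<alpha> i \<oplus>\<^bsub>k\<^esub> \<beta> i) = xe \<alpha> \<oplus>\<^bsub>A\<^esub> xe \<beta>"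
  by (rule kronecker_algebra_eqI) (auto simp: PiE_iff)

lemma x_smult:
  "\<lbrakk>c \<in> carrier k; \<alpha> \<in> {..<r} \<rightarrow>\<^sub>E carrier k\<rbrakk> \<Longrightarrow>
    xe (\<lambda>i\<in>{..<r}. c \<otimes>\<^bsub>k\<^esub> \<alpha> i) = scalar c \<otimes>\<^bsub>A\<^esub> xe \<alpha>"
  by (rule kronecker_algebra_eqI) (auto simp: PiE_iff)

lemma x_zero: "xe (\<lambda>i\<in>{..<r}. \<zero>\<^bsub>k\<^esub>) = \<zero>\<^bsub>A\<^esub>"
  by (rule kronecker_algebra_eqI) auto

sublocale V: vectorspace k "restrict_scalars A M"
proof (rule vs_criteria, goal_cases)
  case 4
  have "\<exists>w\<in>carrier M. v \<oplus>\<^bsub>M\<^esub> w = \<zero>\<^bsub>M\<^esub>" if "v \<in> carrier M" for v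
    using that M.r_neg by blast
  then show ?case
    by (simp add: restrict_scalars_def)
qed (auto simp: restrict_scalars_def M.a_ac smult_l_distr smult_r_distr smult_assoc
    scalar_add scalar_mult scalar_one K.field_axioms)

end

section \<open>Homomorphisms out of $X_U$\<close>

lemma cyclic_left_ideal_simps [simp]:
  "carrier (cyclic_left_ideal R e) = (\<lambda>a. a \<otimes>\<^bsub>R\<^esub> e) ` carrier R"
  "\<zero>\<^bsub>cyclic_left_ideal R e\<^esub> = \<zero>\<^bsub>R\<^esub>"
  "a \<oplus>\<^bsub>cyclic_left_ideal R e\<^esub> b = a \<oplus>\<^bsub>R\<^esub> b"
  "a \<odot>\<^bsub>cyclic_left_ideal R e\<^esub> b = a \<otimes>\<^bsub>R\<^esub> b"
  by (simp_all add: cyclic_left_ideal_def regular_module_def)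

context kronecker_module
begin

lemma restrict_scalars_simps [simp]:
  "carrier (restrict_scalars A M) = carrier M"
  "\<zero>\<^bsub>restrict_scalars A M\<^esub> = \<zero>\<^bsub>M\<^esub>"
  "m \<oplus>\<^bsub>restrict_scalars A M\<^esub> n = m \<oplus>\<^bsub>M\<^esub> n"
  "c \<odot>\<^bsub>restrict_scalars A M\<^esub> m = scalar c \<odot>\<^bsub>M\<^esub> m"
  by (simp_all add: restrict_scalars_def)

text \<open>Scalars are central in the path algebra, so each of its elements acts linearly over
  \<open>k\<close>.\<close>

lemma smult_scalar_commute:
  assumes "c \<in> carrier k" "a \<in> carrier A" "m \<in> carrier M"
  shows "a \<odot>\<^bsub>M\<^esub> (scalar c \<odot>\<^bsub>M\<^esub> m) = scalar c \<odot>\<^bsub>M\<^esub> (a \<odot>\<^bsub>M\<^esub> m)"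
  using assms by (simp add: scalar_mult_left scalar_mult_right flip: smult_assoc)

lemma Soc_subspace:
  assumes "U \<subseteq> {..<r} \<rightarrow>\<^sub>E carrier k"
  shows "VectorSpace.subspace k (Soc k r U M) (restrict_scalars A M)"
proof -
  have "xe \<alpha> \<in> carrier A" if "\<alpha> \<in> U" for \<alpha>
    using that assms by auto
  then have "submodule k (Soc k r U M) (restrict_scalars A M)"
    using V.vectorspace_axioms
    by (auto simp: submodule_def vectorspace_def Soc_def smult_r_distr smult_scalar_commute)
  then show ?thesis
    by (simp add: VectorSpace.subspace_def V.vectorspace_axioms)
qed

lemma scalar_smult_eq_zero:
  assumes "c \<in> carrier k" "m \<in> carrier M" "scalar c \<odot>\<^bsub>M\<^esub> m = \<zero>\<^bsub>M\<^esub>" "m \<noteq> \<zero>\<^bsub>M\<^esub>"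
  shows "c = \<zero>\<^bsub>k\<^esub>"
proof (rule ccontr)
  assume c: "c \<noteq> \<zero>\<^bsub>k\<^esub>"
  then have "m = scalar (inv\<^bsub>k\<^esub> c) \<odot>\<^bsub>M\<^esub> \<zero>\<^bsub>M\<^esub>"
    using V.mult_inverse[of c m "\<zero>\<^bsub>M\<^esub>"] assms by simp
  then show False
    using assms c K.field_Units by simp
qed

text \<open>Arrows start at the vertex 1, that is, \<open>xe \<alpha> = xe \<alpha> e1\<close>. As
  the kernel of \<open>e1\<close> is \<open>M\<^sub>2\<close>, this places \<open>M\<^sub>2\<close>
  inside every socle.\<close>

lemma x_smult_eq_zero_if_e1:
  assumes "\<alpha> \<in> {..<r} \<rightarrow>\<^sub>E carrier k" "m \<in> carrier M" "e1 \<odot>\<^bsub>M\<^esub> m = \<zero>\<^bsub>M\<^esub>"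
  shows "xe \<alpha> \<odot>\<^bsub>M\<^esub> m = \<zero>\<^bsub>M\<^esub>"
  using assms smult_assoc[of "xe \<alpha>" e1 m] by (simp add: x_mult_e1)

text \<open>The \<open>i\<close>-th arrow is \<open>xe\<close> of the \<open>i\<close>-th unit
  vector, and \<open>xe \<alpha>\<close> is a combination of arrows.\<close>

lemma x_smult_eq_zero:
  assumes "\<alpha> \<in> {..<r} \<rightarrow>\<^sub>E carrier k" "m \<in> carrier M"
    and "\<And>i. i < r \<Longrightarrow> xe (unit_vector k r i) \<odot>\<^bsub>M\<^esub> m = \<zero>\<^bsub>M\<^esub>"
  shows "xe \<alpha> \<odot>\<^bsub>M\<^esub> m = \<zero>\<^bsub>M\<^esub>"
proof -
  have arrow: "xe (unit_vector k r i) = path_elem k r (Arrow i)" if "i < r" for i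
    using that K.unit_vector_carrier[of r i]
    by (intro kronecker_algebra_eqI[where k = k and r = r]) (auto simp: unit_vector_def)
  have \<alpha>: "\<alpha> i \<in> carrier k" if "i < r" for i
    using assms(1) that by (auto simp: PiE_iff)
  have "xe \<alpha> \<odot>\<^bsub>M\<^esub> m = (\<Oplus>\<^bsub>M\<^esub>i\<in>{..<r}. (\<alpha> i \<odot>\<^bsub>A\<^esub> path_elem k r (Arrow i)) \<odot>\<^bsub>M\<^esub> m)"
    unfolding x_elem_def using assms \<alpha> by (intro finsum_smult_ldistr) auto
  also have "\<dots> = (\<Oplus>\<^bsub>M\<^esub>i\<in>{..<r}. \<zero>\<^bsub>M\<^esub>)"
  proof (intro M.finsum_cong')
    show "(\<alpha> i \<odot>\<^bsub>A\<^esub> path_elem k r (Arrow i)) \<odot>\<^bsub>M\<^esub> m = \<zero>\<^bsub>M\<^esub>" if "i \<in> {..<r}" for i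
      using that assms(2,3) \<alpha> arrow smult_assoc[of "scalar (\<alpha> i)" "path_elem k r (Arrow i)" m]
      by (simp add: scalar_mult_left)
  qed simp_all
  finally show ?thesis
    by simp
qed

end

text \<open>Here \<open>u\<close> is any basis of \<open>U\<close>; the lemmas are later specialized
  to the basis chosen in \<open>X_mod\<close>.\<close>

locale kronecker_module_family = kronecker_module k r M
  for k :: "('k, 'b) ring_scheme" and r :: nat and M :: "(kpath \<Rightarrow> 'k, 'm) module" +
  fixes d :: nat and U :: "(nat \<Rightarrow> 'k) set" and u :: "nat \<Rightarrow> nat \<Rightarrow> 'k"
  assumes U_subspace: "VectorSpace.subspace k U (coordinate_space k r)"
    and basis_family: "is_basis_family k r d U u"
begin

abbreviation "P1 \<equiv> cyclic_left_ideal A e1"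
abbreviation "N \<equiv> X_presentation k r d u ` carrier (module_power (cyclic_left_ideal A e2) d)"
abbreviation "XU \<equiv> X_of_family k r d u"

sublocale P1: left_module A P1
  by (rule R.left_module_cyclic_left_ideal) simp

lemma U_carrier: "U \<subseteq> {..<r} \<rightarrow>\<^sub>E carrier k"
  using U_subspace by (auto simp: VectorSpace.subspace_def submodule_def)

lemma u_mem: "i < d \<Longrightarrow> u i \<in> U"
proof -
  interpret W: vectorspace k "(coordinate_space k r)\<lparr>carrier := U\<rparr>"
    using vectorspace.subspace_is_vs[OF K.coordinate_space_vectorspace U_subspace] .
  show "i < d \<Longrightarrow> u i \<in> U"
    using basis_family by (auto simp: is_basis_family_def W.basis_def)
qed

lemma u_carrier [simp]: "i < d \<Longrightarrow> u i \<in> {..<r} \<rightarrow>\<^sub>E carrier k"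
  using u_mem U_carrier by blast

text \<open>For fixed \<open>m\<close>, the \<alpha> with \<open>xe \<alpha>\<close> annihilating
  \<open>m\<close> form a subspace, so it is enough to test a spanning family of
  \<open>U\<close>.\<close>

lemma Soc_iff:
  "m \<in> Soc k r U M \<longleftrightarrow> m \<in> carrier M \<and> (\<forall>i<d. xe (u i) \<odot>\<^bsub>M\<^esub> m = \<zero>\<^bsub>M\<^esub>)"
proof
  assume m: "m \<in> carrier M \<and> (\<forall>i<d. xe (u i) \<odot>\<^bsub>M\<^esub> m = \<zero>\<^bsub>M\<^esub>)"
  interpret C: vectorspace k "coordinate_space k r"
    by (rule K.coordinate_space_vectorspace)
  interpret W: vectorspace k "(coordinate_space k r)\<lparr>carrier := U\<rparr>"
    using C.subspace_is_vs[OF U_subspace] .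
  let ?S = "{\<alpha> \<in> {..<r} \<rightarrow>\<^sub>E carrier k. xe \<alpha> \<odot>\<^bsub>M\<^esub> m = \<zero>\<^bsub>M\<^esub>}"
  have S: "submodule k ?S (coordinate_space k r)"
    using C.vectorspace_axioms m
    by (auto simp: submodule_def vectorspace_def x_add x_smult x_zero smult_l_distr smult_assoc
        PiE_mem)
  have "U = W.module.span (u ` {..<d})"
    using basis_family by (simp add: is_basis_family_def W.basis_def)
  \<comment> \<open>The span is moved from \<open>U\<close> to the ambient space, because
    \<open>?S\<close> is a subspace of the latter.\<close>
  also have "\<dots> = C.module.span (u ` {..<d})"
    using C.span_li_not_depend(1)[of "u ` {..<d}" U] u_mem U_subspace
    by (auto simp: VectorSpace.subspace_def)
  also have "\<dots> \<subseteq> ?S"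
    using m u_carrier by (intro C.span_is_subset S) blast
  finally show "m \<in> Soc k r U M"
    using m by (auto simp: Soc_def)
qed (use u_mem in \<open>auto simp: Soc_def\<close>)

section \<open>The submodule of relations\<close>

lemma presentation_arg:
  assumes "a \<in> carrier (module_power (cyclic_left_ideal A e2) d)" "i < d"
  shows "a i \<in> carrier A"
proof -
  have "a i \<in> carrier (cyclic_left_ideal A e2)"
    using assms by (simp add: module_power_def PiE_iff del: cyclic_left_ideal_simps(1))
  then show ?thesis
    by auto
qed

lemma presentation_summands:
  assumes "a \<in> carrier (module_power (cyclic_left_ideal A e2) d)"
  shows "(\<lambda>i. a i \<otimes>\<^bsub>A\<^esub> xe (u i)) \<in> {..<d} \<rightarrow> carrier A"
  using presentation_arg[OF assms] by auto

text \<open>The presentation map is linear over the algebra, so its image is closed under the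
  operations. It lies in \<open>P1\<close> because \<open>xe (u i)\<close> is fixed by
  \<open>e1\<close> on the right.\<close>

lemma relations_submodule: "left_submodule A N P1"
proof -
  interpret P2: left_module A "cyclic_left_ideal A e2"
    by (rule R.left_module_cyclic_left_ideal) simp
  let ?Q = "module_power (cyclic_left_ideal A e2) d"
  have "X_presentation k r d u a \<in> carrier P1" if a: "a \<in> carrier ?Q" for a
  proof -
    let ?b = "X_presentation k r d u a"
    have b: "?b \<in> carrier A"
      using presentation_summands[OF a] unfolding X_presentation_def by (rule R.finsum_closed)
    have "?b \<otimes>\<^bsub>A\<^esub> e1 = (\<Oplus>\<^bsub>A\<^esub>i\<in>{..<d}. a i \<otimes>\<^bsub>A\<^esub> xe (u i) \<otimes>\<^bsub>A\<^esub> e1)"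
      unfolding X_presentation_def using presentation_summands[OF a]
      by (intro R.finsum_ldistr) auto
    also have "\<dots> = ?b"
      unfolding X_presentation_def using presentation_arg[OF a]
      by (intro R.finsum_cong') (auto simp: R.m_assoc x_mult_e1)
    finally show ?thesis
      using b by (auto simp: image_iff intro!: bexI[of _ ?b])
  qed
  moreover have "\<zero>\<^bsub>P1\<^esub> \<in> N"
  proof (rule image_eqI)
    show "\<zero>\<^bsub>?Q\<^esub> \<in> carrier ?Q"
      using P2.M.zero_closed by (auto simp: module_power_def)
    have "X_presentation k r d u \<zero>\<^bsub>?Q\<^esub> = (\<Oplus>\<^bsub>A\<^esub>i\<in>{..<d}. \<zero>\<^bsub>A\<^esub>)"
      unfolding X_presentation_def by (intro R.finsum_cong') (auto simp: module_power_def)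
    then show "\<zero>\<^bsub>P1\<^esub> = X_presentation k r d u \<zero>\<^bsub>?Q\<^esub>"
      by simp
  qed
  moreover have "X_presentation k r d u a \<oplus>\<^bsub>P1\<^esub> X_presentation k r d u b \<in> N"
    if a: "a \<in> carrier ?Q" and b: "b \<in> carrier ?Q" for a b
  proof (rule image_eqI)
    show "a \<oplus>\<^bsub>?Q\<^esub> b \<in> carrier ?Q"
      using a b P2.M.a_closed by (auto simp: module_power_def PiE_iff)
    have "X_presentation k r d u (a \<oplus>\<^bsub>?Q\<^esub> b) =
        (\<Oplus>\<^bsub>A\<^esub>i\<in>{..<d}. a i \<otimes>\<^bsub>A\<^esub> xe (u i) \<oplus>\<^bsub>A\<^esub> b i \<otimes>\<^bsub>A\<^esub> xe (u i))"
      unfolding X_presentation_def using presentation_arg[OF a] presentation_arg[OF b]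
      by (intro R.finsum_cong') (auto simp: module_power_def R.l_distr)
    then show "X_presentation k r d u a \<oplus>\<^bsub>P1\<^esub> X_presentation k r d u b =
        X_presentation k r d u (a \<oplus>\<^bsub>?Q\<^esub> b)"
      using R.finsum_addf[OF presentation_summands[OF a] presentation_summands[OF b]]
      by (simp add: X_presentation_def)
  qed
  moreover have "c \<odot>\<^bsub>P1\<^esub> X_presentation k r d u a \<in> N"
    if c: "c \<in> carrier A" and a: "a \<in> carrier ?Q" for c a
  proof (rule image_eqI)
    show "c \<odot>\<^bsub>?Q\<^esub> a \<in> carrier ?Q"
      using c a P2.smult_closed by (auto simp: module_power_def PiE_iff)
    have "X_presentation k r d u (c \<odot>\<^bsub>?Q\<^esub> a) = (\<Oplus>\<^bsub>A\<^esub>i\<in>{..<d}. c \<otimes>\<^bsub>A\<^esub> (a i \<otimes>\<^bsub>A\<^esub> xe (u i)))"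
      unfolding X_presentation_def using presentation_arg[OF a] c
      by (intro R.finsum_cong') (auto simp: module_power_def R.m_assoc)
    then show "c \<odot>\<^bsub>P1\<^esub> X_presentation k r d u a = X_presentation k r d u (c \<odot>\<^bsub>?Q\<^esub> a)"
      using R.finsum_rdistr[OF _ c presentation_summands[OF a]]
      by (simp add: X_presentation_def)
  qed
  ultimately show ?thesis
    unfolding left_submodule_def by blast
qed

text \<open>A relation is a sum of left multiples of the \<open>xe (u i)\<close>, all of which kill
  \<open>m\<close>. This makes the action of a coset on \<open>m\<close> well defined.\<close>

lemma relations_annihilate:
  assumes "m \<in> Soc k r U M" "b \<in> N"
  shows "b \<odot>\<^bsub>M\<^esub> m = \<zero>\<^bsub>M\<^esub>"
proof -
  obtain a where a: "a \<in> carrier (module_power (cyclic_left_ideal A e2) d)"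
    "b = X_presentation k r d u a"
    using assms(2) by blast
  have m: "m \<in> carrier M" "\<And>i. i < d \<Longrightarrow> xe (u i) \<odot>\<^bsub>M\<^esub> m = \<zero>\<^bsub>M\<^esub>"
    using assms(1) by (auto simp: Soc_iff)
  have "b \<odot>\<^bsub>M\<^esub> m = (\<Oplus>\<^bsub>M\<^esub>i\<in>{..<d}. (a i \<otimes>\<^bsub>A\<^esub> xe (u i)) \<odot>\<^bsub>M\<^esub> m)"
    unfolding a(2) X_presentation_def
    by (rule finsum_smult_ldistr) (use presentation_summands[OF a(1)] m in auto)
  also have "\<dots> = (\<Oplus>\<^bsub>M\<^esub>i\<in>{..<d}. \<zero>\<^bsub>M\<^esub>)"
    using presentation_arg[OF a(1)] m by (intro M.finsum_cong') (auto simp: smult_assoc)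
  finally show ?thesis
    by simp
qed

text \<open>The preimage is the tuple with \<open>e2\<close> in place \<open>i\<close> and zero
  elsewhere. These relations force the image of the class of \<open>e1\<close> under a homomorphism
  into the socle.\<close>

lemma x_in_relations:
  assumes "i < d"
  shows "xe (u i) \<in> N"
proof (rule image_eqI)
  let ?a = "\<lambda>j\<in>{..<d}. if i = j then e2 else \<zero>\<^bsub>A\<^esub>"
  have "e2 \<otimes>\<^bsub>A\<^esub> e2 = e2"
    by (rule kronecker_algebra_eqI) auto
  then have "e2 \<in> (\<lambda>b. b \<otimes>\<^bsub>A\<^esub> e2) ` carrier A" "\<zero>\<^bsub>A\<^esub> \<in> (\<lambda>b. b \<otimes>\<^bsub>A\<^esub> e2) ` carrier A"
    using image_eqI[of e2 "\<lambda>b. b \<otimes>\<^bsub>A\<^esub> e2" e2 "carrier A"]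
      image_eqI[of "\<zero>\<^bsub>A\<^esub>" "\<lambda>b. b \<otimes>\<^bsub>A\<^esub> e2" "\<zero>\<^bsub>A\<^esub>" "carrier A"] by simp_all
  then show "?a \<in> carrier (module_power (cyclic_left_ideal A e2) d)"
    by (simp add: module_power_def)
  have "X_presentation k r d u ?a = (\<Oplus>\<^bsub>A\<^esub>j\<in>{..<d}. if i = j then xe (u j) else \<zero>\<^bsub>A\<^esub>)"
    unfolding X_presentation_def by (intro R.finsum_cong') (auto simp: e2_mult_x)
  also have "\<dots> = xe (u i)"
    using assms by (intro R.finsum_singleton) auto
  finally show "xe (u i) = X_presentation k r d u ?a"
    by simp
qed

section \<open>Socle elements as homomorphisms out of \<open>XU\<close>\<close>

lemma X_carrier: "carrier XU = (\<lambda>a. N +>\<^bsub>P1\<^esub> a) ` carrier P1"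
  unfolding X_of_family_def cokernel_def by (rule P1.quotient_carrier)

lemma X_add:
  "\<lbrakk>a \<in> carrier P1; b \<in> carrier P1\<rbrakk> \<Longrightarrow>
    (N +>\<^bsub>P1\<^esub> a) \<oplus>\<^bsub>XU\<^esub> (N +>\<^bsub>P1\<^esub> b) = N +>\<^bsub>P1\<^esub> (a \<oplus>\<^bsub>A\<^esub> b)"
  unfolding X_of_family_def cokernel_def
  using P1.quotient_add[OF relations_submodule] by simp

lemma X_smult:
  "\<lbrakk>a \<in> carrier A; b \<in> carrier P1\<rbrakk> \<Longrightarrow>
    a \<odot>\<^bsub>XU\<^esub> (N +>\<^bsub>P1\<^esub> b) = N +>\<^bsub>P1\<^esub> (a \<otimes>\<^bsub>A\<^esub> b)"
  unfolding X_of_family_def cokernel_def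
  using P1.quotient_smult[OF relations_submodule] by simp

text \<open>A coset acts through an arbitrary representative, which is harmless when
  \<open>m\<close> lies in the socle. The restriction to the carrier is due to
  \<open>hom_space\<close> consisting of extensional maps.\<close>

definition hom_of :: "'m \<Rightarrow> (kpath \<Rightarrow> 'k) set \<Rightarrow> 'm" where
  "hom_of m = (\<lambda>C\<in>carrier XU. (SOME a. a \<in> C) \<odot>\<^bsub>M\<^esub> m)"

lemma P1_carrier_closed: "a \<in> carrier P1 \<Longrightarrow> a \<in> carrier A"
  by auto

text \<open>Two representatives of a coset differ by a relation, and relations annihilate
  \<open>m\<close>.\<close>

lemma hom_of_coset:
  assumes m: "m \<in> Soc k r U M" and a: "a \<in> carrier P1"
  shows "hom_of m (N +>\<^bsub>P1\<^esub> a) = a \<odot>\<^bsub>M\<^esub> m"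
proof -
  define b where "b = (SOME b. b \<in> N +>\<^bsub>P1\<^esub> a)"
  have "b \<in> N +>\<^bsub>P1\<^esub> a"
    unfolding b_def
    using someI[of "\<lambda>b. b \<in> N +>\<^bsub>P1\<^esub> a", OF P1.coset_self[OF relations_submodule a]] .
  then obtain n where n: "n \<in> N" "b = n \<oplus>\<^bsub>P1\<^esub> a"
    by (rule P1.coset_memE)
  have "n \<in> carrier A"
    using n relations_submodule P1_carrier_closed unfolding left_submodule_def by blast
  then have "b \<odot>\<^bsub>M\<^esub> m = a \<odot>\<^bsub>M\<^esub> m"
    using n a m relations_annihilate[OF m n(1)] P1_carrier_closed[OF a]
    by (simp add: smult_l_distr Soc_iff)
  moreover have "N +>\<^bsub>P1\<^esub> a \<in> carrier XU"
    unfolding X_carrier using a by blast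
  ultimately show ?thesis
    by (simp add: hom_of_def b_def)
qed

lemma X_hom_eqI:
  assumes "f \<in> extensional (carrier XU)" "g \<in> extensional (carrier XU)"
    and "\<And>a. a \<in> carrier P1 \<Longrightarrow> f (N +>\<^bsub>P1\<^esub> a) = g (N +>\<^bsub>P1\<^esub> a)"
  shows "f = g"
  using assms by (intro extensionalityI[of f "carrier XU"])
    (auto simp: X_carrier simp del: cyclic_left_ideal_simps)

abbreviation "H \<equiv> hom_space A XU M"

lemma hom_of_extensional: "hom_of m \<in> extensional (carrier XU)"
  by (simp add: hom_of_def)

lemma hom_of_closed:
  assumes m: "m \<in> Soc k r U M"
  shows "hom_of m \<in> carrier H"
proof -
  have mM: "m \<in> carrier M"
    using m by (simp add: Soc_iff)
  have all: "(\<forall>C\<in>carrier XU. Q C) \<longleftrightarrow> (\<forall>a\<in>carrier P1. Q (N +>\<^bsub>P1\<^esub> a))" for Q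
    unfolding X_carrier by blast
  have "\<forall>C\<in>carrier XU. hom_of m C \<in> carrier M"
    unfolding all using hom_of_coset[OF m] P1_carrier_closed mM by simp
  moreover have "\<forall>C\<in>carrier XU. \<forall>D\<in>carrier XU. hom_of m (C \<oplus>\<^bsub>XU\<^esub> D) = hom_of m C \<oplus>\<^bsub>M\<^esub> hom_of m D"
    unfolding all
    using hom_of_coset[OF m] P1_carrier_closed mM P1.M.a_closed
    by (simp add: X_add smult_l_distr del: cyclic_left_ideal_simps(1))
  moreover have "\<forall>a\<in>carrier A. \<forall>C\<in>carrier XU. hom_of m (a \<odot>\<^bsub>XU\<^esub> C) = a \<odot>\<^bsub>M\<^esub> hom_of m C"
    unfolding all
    using hom_of_coset[OF m] P1_carrier_closed mM P1.smult_closed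
    by (simp add: X_smult smult_assoc del: cyclic_left_ideal_simps(1))
  ultimately show ?thesis
    using hom_of_extensional by (auto simp: hom_space_def LinearCombinations.module_hom_def)
qed

lemma e1_P1: "e1 \<in> carrier P1"
  using e1_idem by (auto simp: image_iff intro!: bexI[of _ e1])

text \<open>The class of \<open>e1\<close> generates \<open>XU\<close>, so \<open>f\<close> is
  determined by its value there, and the relations put this value into the socle.\<close>

lemma hom_of_surj:
  assumes f: "f \<in> carrier H"
  shows "\<exists>m\<in>Soc k r U M. hom_of m = f"
proof
  let ?m = "f (N +>\<^bsub>P1\<^esub> e1)"
  have C: "N +>\<^bsub>P1\<^esub> a \<in> carrier XU" if "a \<in> carrier P1" for a
    unfolding X_carrier using that by blast
  have hom: "f (a \<odot>\<^bsub>XU\<^esub> C) = a \<odot>\<^bsub>M\<^esub> f C" if "a \<in> carrier A" "C \<in> carrier XU" for a C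
    using f that by (auto simp: hom_space_def LinearCombinations.module_hom_def)
  have mM: "?m \<in> carrier M"
    using f C[OF e1_P1] by (auto simp: hom_space_def LinearCombinations.module_hom_def)
  have eq: "f (N +>\<^bsub>P1\<^esub> (a \<otimes>\<^bsub>A\<^esub> e1)) = a \<odot>\<^bsub>M\<^esub> ?m" if "a \<in> carrier A" for a
    using hom[OF that C[OF e1_P1]] X_smult[OF that e1_P1] by simp
  \<comment> \<open>The coset \<open>N\<close> is the class of zero and also the class of each
    relation \<open>xe (u i)\<close>.\<close>
  have "f N = \<zero>\<^bsub>M\<^esub>"
    using eq[of "\<zero>\<^bsub>A\<^esub>"] mM relations_submodule
      P1.quotient_zero_coset[OF relations_submodule, of "\<zero>\<^bsub>A\<^esub>"]
    by (simp add: left_submodule_def)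
  then have "xe (u i) \<odot>\<^bsub>M\<^esub> ?m = \<zero>\<^bsub>M\<^esub>" if "i < d" for i
    using eq[of "xe (u i)"] that x_in_relations[OF that]
      P1.quotient_zero_coset[OF relations_submodule, of "xe (u i)"]
    by (simp add: x_mult_e1)
  then show m: "?m \<in> Soc k r U M"
    using mM by (simp add: Soc_iff)
  show "hom_of ?m = f"
  proof (rule X_hom_eqI)
    show "f \<in> extensional (carrier XU)"
      using f by (simp add: hom_space_def)
    fix a assume a: "a \<in> carrier P1"
    then have "a \<otimes>\<^bsub>A\<^esub> e1 = a"
      by (auto simp: R.m_assoc e1_idem)
    then show "hom_of ?m (N +>\<^bsub>P1\<^esub> a) = f (N +>\<^bsub>P1\<^esub> a)"
      using hom_of_coset[OF m a] eq[OF P1_carrier_closed[OF a]] by simp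
  qed (rule hom_of_extensional)
qed

text \<open>The elements of \<open>P1\<close> have the form \<open>b e1\<close>, so
  \<open>hom_of m\<close> depends on \<open>e1 m\<close> alone; the kernel is
  \<open>M\<^sub>2\<close>.\<close>

lemma hom_of_eq_zero_iff:
  assumes m: "m \<in> Soc k r U M"
  shows "hom_of m = \<zero>\<^bsub>H\<^esub> \<longleftrightarrow> e1 \<odot>\<^bsub>M\<^esub> m = \<zero>\<^bsub>M\<^esub>"
proof
  assume "hom_of m = \<zero>\<^bsub>H\<^esub>"
  moreover have "N +>\<^bsub>P1\<^esub> e1 \<in> carrier XU"
    unfolding X_carrier using e1_P1 by blast
  ultimately show "e1 \<odot>\<^bsub>M\<^esub> m = \<zero>\<^bsub>M\<^esub>"
    using hom_of_coset[OF m e1_P1] by (simp add: hom_space_def)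
next
  assume e: "e1 \<odot>\<^bsub>M\<^esub> m = \<zero>\<^bsub>M\<^esub>"
  show "hom_of m = \<zero>\<^bsub>H\<^esub>"
  proof (rule X_hom_eqI[OF hom_of_extensional])
    show "\<zero>\<^bsub>H\<^esub> \<in> extensional (carrier XU)"
      by (simp add: hom_space_def)
    fix a assume a: "a \<in> carrier P1"
    then obtain b where "b \<in> carrier A" "a = b \<otimes>\<^bsub>A\<^esub> e1"
      by auto
    then have "a \<odot>\<^bsub>M\<^esub> m = \<zero>\<^bsub>M\<^esub>"
      using e m by (simp add: smult_assoc Soc_iff)
    moreover have "N +>\<^bsub>P1\<^esub> a \<in> carrier XU"
      unfolding X_carrier using a by blast
    ultimately show "hom_of m (N +>\<^bsub>P1\<^esub> a) = \<zero>\<^bsub>H\<^esub> (N +>\<^bsub>P1\<^esub> a)"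
      using hom_of_coset[OF m a] by (simp add: hom_space_def)
  qed
qed

end

section \<open>Linearity of \<open>hom_of\<close> and the dimension of the socle\<close>

context kronecker_module_family
begin

lemma restrict_scalars_carrier_update:
  "restrict_scalars A (M\<lparr>carrier := E\<rparr>) = (restrict_scalars A M)\<lparr>carrier := E\<rparr>"
  by (simp add: restrict_scalars_def)

text \<open>Besides linearity this contains that \<open>H\<close> is a vector space, obtained from
  surjectivity through \<open>linear_map_if_surj\<close>.\<close>

lemma hom_of_linear_map:
  "linear_map k (restrict_scalars A (M\<lparr>carrier := Soc k r U M\<rparr>)) H hom_of"
proof -
  let ?S = "restrict_scalars A (M\<lparr>carrier := Soc k r U M\<rparr>)"
  have S: "vectorspace k ?S"
    using V.subspace_is_vs[OF Soc_subspace[OF U_carrier]] by (simp add: restrict_scalars_carrier_update)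
  interpret S: vectorspace k ?S
    by (rule S)
  have simps: "carrier ?S = Soc k r U M" "m \<oplus>\<^bsub>?S\<^esub> n = m \<oplus>\<^bsub>M\<^esub> n"
    "c \<odot>\<^bsub>?S\<^esub> m = scalar c \<odot>\<^bsub>M\<^esub> m" "\<zero>\<^bsub>?S\<^esub> = \<zero>\<^bsub>M\<^esub>" for m n c
    by (simp_all add: restrict_scalars_def)
  have coset: "N +>\<^bsub>P1\<^esub> a \<in> carrier XU" if "a \<in> carrier P1" for a
    unfolding X_carrier using that by blast
  have SocM: "m \<in> Soc k r U M \<Longrightarrow> m \<in> carrier M" for m
    by (simp add: Soc_def)
  show ?thesis
  proof (rule S.linear_map_if_surj)
    show "hom_of ` carrier ?S = carrier H"
      using hom_of_closed hom_of_surj by (force simp: simps)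
    show "hom_of (m \<oplus>\<^bsub>?S\<^esub> n) = hom_of m \<oplus>\<^bsub>H\<^esub> hom_of n"
      if m: "m \<in> carrier ?S" and n: "n \<in> carrier ?S" for m n
    proof (rule X_hom_eqI[OF hom_of_extensional])
      show "hom_of m \<oplus>\<^bsub>H\<^esub> hom_of n \<in> extensional (carrier XU)"
        by (simp add: hom_space_def)
      fix a assume a: "a \<in> carrier P1"
      have "m \<oplus>\<^bsub>M\<^esub> n \<in> Soc k r U M"
        using S.module.M.a_closed[OF m n] by (simp add: simps)
      then show "hom_of (m \<oplus>\<^bsub>?S\<^esub> n) (N +>\<^bsub>P1\<^esub> a) = (hom_of m \<oplus>\<^bsub>H\<^esub> hom_of n) (N +>\<^bsub>P1\<^esub> a)"
        using m n a coset[OF a] P1_carrier_closed[OF a] SocM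
        by (simp add: simps hom_space_def hom_of_coset smult_r_distr
            del: cyclic_left_ideal_simps(1))
    qed
    show "hom_of (c \<odot>\<^bsub>?S\<^esub> m) = c \<odot>\<^bsub>H\<^esub> hom_of m"
      if c: "c \<in> carrier k" and m: "m \<in> carrier ?S" for c m
    proof (rule X_hom_eqI[OF hom_of_extensional])
      show "c \<odot>\<^bsub>H\<^esub> hom_of m \<in> extensional (carrier XU)"
        by (simp add: hom_space_def)
      fix a assume a: "a \<in> carrier P1"
      have "scalar c \<odot>\<^bsub>M\<^esub> m \<in> Soc k r U M"
        using S.module.smult_closed[OF c m] by (simp add: simps)
      then show "hom_of (c \<odot>\<^bsub>?S\<^esub> m) (N +>\<^bsub>P1\<^esub> a) = (c \<odot>\<^bsub>H\<^esub> hom_of m) (N +>\<^bsub>P1\<^esub> a)"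
        using c m a coset[OF a] P1_carrier_closed[OF a] SocM
        by (simp add: simps hom_space_def hom_of_coset smult_scalar_commute
            del: cyclic_left_ideal_simps(1))
    qed
    show "hom_of \<zero>\<^bsub>?S\<^esub> = \<zero>\<^bsub>H\<^esub>"
      using hom_of_eq_zero_iff[of "\<zero>\<^bsub>M\<^esub>"] S.module.M.zero_closed by (simp add: simps)
  qed
qed

text \<open>Rank and nullity of \<open>hom_of\<close>: the image is all of \<open>H\<close>, and the
  kernel is \<open>M\<^sub>2\<close>, whose dimension does not involve \<open>U\<close>.\<close>

lemma dim_Soc:
  assumes fd: "V.fin_dim"
  shows "vectorspace.dim k (restrict_scalars A (M\<lparr>carrier := Soc k r U M\<rparr>)) =
    vectorspace.dim k H +
    vectorspace.dim k (restrict_scalars A (M\<lparr>carrier := {m \<in> carrier M. e1 \<odot>\<^bsub>M\<^esub> m = \<zero>\<^bsub>M\<^esub>}\<rparr>))"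
proof -
  let ?S = "restrict_scalars A (M\<lparr>carrier := Soc k r U M\<rparr>)"
  interpret T: linear_map k ?S H hom_of
    by (rule hom_of_linear_map)
  have carrier_S: "carrier ?S = Soc k r U M"
    by (simp add: restrict_scalars_def)
  have "T.V.fin_dim"
    using V.fin_dim_subspace[OF fd Soc_subspace[OF U_carrier]]
    by (simp add: restrict_scalars_carrier_update)
  then have "vectorspace.dim k (H\<lparr>carrier := T.im\<rparr>) + vectorspace.dim k (?S\<lparr>carrier := T.ker\<rparr>) =
      vectorspace.dim k ?S"
    by (rule T.rank_nullity)
  moreover have "T.im = carrier H"
    using hom_of_closed hom_of_surj by (force simp: T.im_def carrier_S)
  moreover have "T.ker = {m \<in> carrier M. e1 \<odot>\<^bsub>M\<^esub> m = \<zero>\<^bsub>M\<^esub>}"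
  proof -
    have "m \<in> Soc k r U M" if "m \<in> carrier M" "e1 \<odot>\<^bsub>M\<^esub> m = \<zero>\<^bsub>M\<^esub>" for m
      using that U_carrier x_smult_eq_zero_if_e1 by (auto simp: Soc_def)
    moreover have "m \<in> carrier M" if "m \<in> Soc k r U M" for m
      using that by (simp add: Soc_def)
    ultimately show ?thesis
      using hom_of_eq_zero_iff unfolding T.ker_def carrier_S by blast
  qed
  ultimately show ?thesis
    by (simp add: restrict_scalars_def)
qed

text \<open>As \<open>hom_of\<close> maps onto \<open>H\<close>, the latter vanishes exactly when
  the whole socle lies in the kernel of \<open>hom_of\<close>.\<close>

lemma hom_zero_iff:
  "carrier H = {\<zero>\<^bsub>H\<^esub>} \<longleftrightarrow> (\<forall>m\<in>Soc k r U M. e1 \<odot>\<^bsub>M\<^esub> m = \<zero>\<^bsub>M\<^esub>)"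
proof
  show "\<forall>m\<in>Soc k r U M. e1 \<odot>\<^bsub>M\<^esub> m = \<zero>\<^bsub>M\<^esub>" if "carrier H = {\<zero>\<^bsub>H\<^esub>}"
    using that hom_of_closed hom_of_eq_zero_iff by blast
  assume *: "\<forall>m\<in>Soc k r U M. e1 \<odot>\<^bsub>M\<^esub> m = \<zero>\<^bsub>M\<^esub>"
  have "\<zero>\<^bsub>M\<^esub> \<in> Soc k r U M"
    by (simp add: Soc_iff)
  then have "\<zero>\<^bsub>H\<^esub> \<in> carrier H"
    using * hom_of_closed hom_of_eq_zero_iff by metis
  moreover have "f = \<zero>\<^bsub>H\<^esub>" if "f \<in> carrier H" for f
    using hom_of_surj[OF that] * hom_of_eq_zero_iff by blast
  ultimately show "carrier H = {\<zero>\<^bsub>H\<^esub>}"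
    by blast
qed

end

section \<open>Summands isomorphic to \<open>simple1 k\<close> and equal socles\<close>

context kronecker_module
begin

lemma X_mod_family:
  assumes "U \<in> grassmannian k d r"
  shows "kronecker_module_family k r M d U (SOME u. is_basis_family k r d U u)"
proof (intro kronecker_module_family.intro kronecker_module_axioms
    kronecker_module_family_axioms.intro)
  show "VectorSpace.subspace k U (coordinate_space k r)"
    using assms by (simp add: grassmannian_def)
  show "is_basis_family k r d U (SOME u. is_basis_family k r d U u)"
    using K.grassmannian_basis_family[OF assms] by (metis someI)
qed

lemma grassmannian_carrier:
  assumes "U \<in> grassmannian k d r"
  shows "U \<subseteq> {..<r} \<rightarrow>\<^sub>E carrier k"
  using assms by (auto simp: grassmannian_def VectorSpace.subspace_def submodule_def)

text \<open>Every socle contains \<open>M\<^sub>2\<close>, and vanishing of the homomorphisms leaves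
  nothing else. The right-hand side is free of \<open>U\<close>, whence the equal socle
  property.\<close>

lemma Soc_eq_if_hom_zero:
  assumes U: "U \<in> grassmannian k d r"
    and zero: "carrier (hom_space A (X_mod k r d U) M) = {\<zero>\<^bsub>hom_space A (X_mod k r d U) M\<^esub>}"
  shows "Soc k r U M = {m \<in> carrier M. e1 \<odot>\<^bsub>M\<^esub> m = \<zero>\<^bsub>M\<^esub>}"
proof -
  interpret F: kronecker_module_family k r M d U "SOME u. is_basis_family k r d U u"
    by (rule X_mod_family[OF U])
  show ?thesis
    using zero[unfolded X_mod_def F.hom_zero_iff] grassmannian_carrier[OF U] x_smult_eq_zero_if_e1
    by (auto simp: Soc_def)
qed

text \<open>The line through \<open>n\<close> is a submodule. A hyperplane \<open>W\<close> avoiding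
  \<open>n\<close> need not be one, but its preimage under \<open>e1\<close> is, and it is still a
  complement.\<close>

lemma simple1_summandI:
  assumes fd: "V.fin_dim" and n: "n \<in> carrier M" "n \<noteq> \<zero>\<^bsub>M\<^esub>" "e1 \<odot>\<^bsub>M\<^esub> n = n"
    and xe: "\<And>\<alpha>. \<alpha> \<in> {..<r} \<rightarrow>\<^sub>E carrier k \<Longrightarrow> xe \<alpha> \<odot>\<^bsub>M\<^esub> n = \<zero>\<^bsub>M\<^esub>"
  shows "has_summand_iso_to A M (simple1 k)"
proof -
  \<comment> \<open>Since \<open>n = e1 n\<close>, only \<open>a e1\<close> matters, and its arrow
    part kills \<open>n\<close>.\<close>
  have act: "a \<odot>\<^bsub>M\<^esub> n = scalar (a Triv1) \<odot>\<^bsub>M\<^esub> n" if a: "a \<in> carrier A" for a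
  proof -
    let ?\<alpha> = "\<lambda>i\<in>{..<r}. a (Arrow i)"
    have \<alpha>: "?\<alpha> \<in> {..<r} \<rightarrow>\<^sub>E carrier k"
      using a by auto
    have "a \<odot>\<^bsub>M\<^esub> n = (a \<otimes>\<^bsub>A\<^esub> e1) \<odot>\<^bsub>M\<^esub> n"
      using a n by (simp add: smult_assoc)
    also have "\<dots> = (scalar (a Triv1) \<otimes>\<^bsub>A\<^esub> e1) \<odot>\<^bsub>M\<^esub> n \<oplus>\<^bsub>M\<^esub> xe ?\<alpha> \<odot>\<^bsub>M\<^esub> n"
      using a n \<alpha> by (simp add: mult_e1_decomp[OF a] smult_l_distr)
    also have "\<dots> = scalar (a Triv1) \<odot>\<^bsub>M\<^esub> n"
      using a n xe[OF \<alpha>] by (simp add: smult_assoc)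
    finally show ?thesis .
  qed
  obtain W where W: "VectorSpace.subspace k W (restrict_scalars A M)" "n \<notin> W"
    "\<And>v. v \<in> carrier M \<Longrightarrow> \<exists>c\<in>carrier k. \<exists>w\<in>W. v = scalar c \<odot>\<^bsub>M\<^esub> n \<oplus>\<^bsub>M\<^esub> w"
    using V.line_complement[OF fd, of n] n by auto
  have W_closed: "W \<subseteq> carrier M" "\<zero>\<^bsub>M\<^esub> \<in> W" "\<And>v w. \<lbrakk>v \<in> W; w \<in> W\<rbrakk> \<Longrightarrow> v \<oplus>\<^bsub>M\<^esub> w \<in> W"
    "\<And>c w. \<lbrakk>c \<in> carrier k; w \<in> W\<rbrakk> \<Longrightarrow> scalar c \<odot>\<^bsub>M\<^esub> w \<in> W"
    using W(1) by (auto simp: VectorSpace.subspace_def submodule_def)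
  let ?g = "\<lambda>c. scalar c \<odot>\<^bsub>M\<^esub> n"
  define N where "N = ?g ` carrier k"
  \<comment> \<open>Stability under \<open>a\<close> follows from
    \<open>e1 a = scalar (a Triv1) e1\<close>, as \<open>W\<close> is closed under scalars.\<close>
  define L where "L = {m \<in> carrier M. e1 \<odot>\<^bsub>M\<^esub> m \<in> W}"
  have g_closed: "?g c \<in> carrier M" if "c \<in> carrier k" for c
    using that n by simp
  have g_add: "?g (c \<oplus>\<^bsub>k\<^esub> c') = ?g c \<oplus>\<^bsub>M\<^esub> ?g c'" if "c \<in> carrier k" "c' \<in> carrier k" for c c'
    using that n by (simp add: scalar_add smult_l_distr)
  have g_smult: "a \<odot>\<^bsub>M\<^esub> ?g c = ?g (a Triv1 \<otimes>\<^bsub>k\<^esub> c)" if "a \<in> carrier A" "c \<in> carrier k" for a c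
  proof -
    have "a \<odot>\<^bsub>M\<^esub> ?g c = scalar c \<odot>\<^bsub>M\<^esub> (scalar (a Triv1) \<odot>\<^bsub>M\<^esub> n)"
      using smult_scalar_commute[OF that(2,1) n(1)] act[OF that(1)] by simp
    also have "\<dots> = ?g (c \<otimes>\<^bsub>k\<^esub> a Triv1)"
      using that n by (simp add: scalar_mult smult_assoc)
    finally show ?thesis
      using that by (simp add: K.m_comm)
  qed
  have e1_g: "e1 \<odot>\<^bsub>M\<^esub> ?g c = ?g c" if "c \<in> carrier k" for c
    using that n by (simp add: smult_scalar_commute)
  have g_inj: "inj_on ?g (carrier k)"
  proof (rule inj_onI)
    fix c c' assume c: "c \<in> carrier k" "c' \<in> carrier k" "?g c = ?g c'"
    have "?g (c \<ominus>\<^bsub>k\<^esub> c') \<oplus>\<^bsub>M\<^esub> ?g c' = \<zero>\<^bsub>M\<^esub> \<oplus>\<^bsub>M\<^esub> ?g c'"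
      using c g_closed g_add[of "c \<ominus>\<^bsub>k\<^esub> c'" c'] by (simp add: K.minus_eq K.a_assoc K.l_neg)
    then have "?g (c \<ominus>\<^bsub>k\<^esub> c') = \<zero>\<^bsub>M\<^esub>"
      using c g_closed by (simp add: K.minus_eq)
    then show "c = c'"
      using scalar_smult_eq_zero[of "c \<ominus>\<^bsub>k\<^esub> c'" n] c n by simp
  qed
  have "left_submodule A N M"
    unfolding left_submodule_def
  proof (intro conjI ballI)
    show "N \<subseteq> carrier M"
      using g_closed by (auto simp: N_def)
    show "\<zero>\<^bsub>M\<^esub> \<in> N"
      using n by (auto simp: N_def image_iff scalar_zero intro!: bexI[of _ "\<zero>\<^bsub>k\<^esub>"])
    show "v \<oplus>\<^bsub>M\<^esub> w \<in> N" if "v \<in> N" "w \<in> N" for v w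
      using that by (auto simp: N_def simp flip: g_add)
    show "a \<odot>\<^bsub>M\<^esub> v \<in> N" if "a \<in> carrier A" "v \<in> N" for a v
      using that g_smult by (auto simp: N_def)
  qed
  moreover have "left_submodule A L M"
    unfolding left_submodule_def
  proof (intro conjI ballI)
    show "a \<odot>\<^bsub>M\<^esub> v \<in> L" if a: "a \<in> carrier A" and v: "v \<in> L" for a v
    proof -
      have "e1 \<odot>\<^bsub>M\<^esub> (a \<odot>\<^bsub>M\<^esub> v) = scalar (a Triv1) \<odot>\<^bsub>M\<^esub> (e1 \<odot>\<^bsub>M\<^esub> v)"
        using a v e1_mult[OF a] by (simp add: L_def flip: smult_assoc)
      then show ?thesis
        using a v W_closed(4) by (simp add: L_def)
    qed
  qed (auto simp: L_def smult_r_distr W_closed)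
  moreover have "N \<inter> L = {\<zero>\<^bsub>M\<^esub>}"
  proof -
    have "?g c = \<zero>\<^bsub>M\<^esub>" if c: "c \<in> carrier k" and "?g c \<in> L" for c
    proof (rule ccontr)
      assume "?g c \<noteq> \<zero>\<^bsub>M\<^esub>"
      then have c0: "c \<noteq> \<zero>\<^bsub>k\<^esub>"
        using n by (auto simp: scalar_zero)
      \<comment> \<open>On the line \<open>e1\<close> is the identity, so membership in
        \<open>L\<close> means membership in \<open>W\<close>; dividing by \<open>c\<close> would
        put \<open>n\<close> into \<open>W\<close>.\<close>
      have "?g c \<in> W"
        using that e1_g by (simp add: L_def)
      then have "scalar (inv\<^bsub>k\<^esub> c) \<odot>\<^bsub>M\<^esub> ?g c \<in> W"
        using W_closed(4) c c0 K.field_Units by simp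
      moreover have "scalar (inv\<^bsub>k\<^esub> c) \<odot>\<^bsub>M\<^esub> ?g c = n"
        using V.mult_inverse[of c n "?g c"] c c0 n by simp
      ultimately show False
        using W(2) by simp
    qed
    then show ?thesis
      using \<open>left_submodule A N M\<close> \<open>left_submodule A L M\<close>
      by (auto simp: N_def left_submodule_def)
  qed
  moreover have "\<forall>m\<in>carrier M. \<exists>v\<in>N. \<exists>w\<in>L. m = v \<oplus>\<^bsub>M\<^esub> w"
  proof
    fix m assume m: "m \<in> carrier M"
    then obtain c w where c: "c \<in> carrier k" "w \<in> W" "e1 \<odot>\<^bsub>M\<^esub> m = ?g c \<oplus>\<^bsub>M\<^esub> w"
      using W(3)[of "e1 \<odot>\<^bsub>M\<^esub> m"] by auto
    have wM: "w \<in> carrier M"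
      using c W_closed by auto
    \<comment> \<open>Subtracting from \<open>m\<close> the component of \<open>e1 m\<close> along
      \<open>n\<close> leaves an element that \<open>e1\<close> sends to
      \<open>w \<in> W\<close>.\<close>
    let ?w = "\<ominus>\<^bsub>M\<^esub> ?g c \<oplus>\<^bsub>M\<^esub> m"
    have "\<ominus>\<^bsub>M\<^esub> ?g c = ?g (\<ominus>\<^bsub>k\<^esub> c)"
      using c g_closed g_add[of "\<ominus>\<^bsub>k\<^esub> c" c] n
      by (intro M.minus_equality) (simp_all add: K.l_neg scalar_zero)
    then have "e1 \<odot>\<^bsub>M\<^esub> ?w = \<ominus>\<^bsub>M\<^esub> ?g c \<oplus>\<^bsub>M\<^esub> (?g c \<oplus>\<^bsub>M\<^esub> w)"
      using c m e1_g g_closed by (simp add: smult_r_distr)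
    also have "\<dots> = w"
      using c(1) wM g_closed by (simp add: M.r_neg1)
    finally have "?w \<in> L"
      using c m g_closed by (simp add: L_def)
    moreover have "m = ?g c \<oplus>\<^bsub>M\<^esub> ?w"
      using c m g_closed by (simp add: M.r_neg2)
    ultimately show "\<exists>v\<in>N. \<exists>w\<in>L. m = v \<oplus>\<^bsub>M\<^esub> w"
      using c by (auto simp: N_def)
  qed
  moreover have "module_iso A (M\<lparr>carrier := N\<rparr>) (simple1 k)"
    unfolding module_iso_def
  proof (rule bexI)
    let ?f = "the_inv_into (carrier k) ?g"
    have f_g: "?f (?g c) = c" if "c \<in> carrier k" for c
      using that by (rule the_inv_into_f_f[OF g_inj])
    show "bij_betw ?f (carrier (M\<lparr>carrier := N\<rparr>)) (carrier (simple1 k))"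
      using bij_betw_the_inv_into[of ?g "carrier k" N] g_inj
      by (simp add: bij_betw_def N_def simple1_def)
    show "?f \<in> LinearCombinations.module_hom A (M\<lparr>carrier := N\<rparr>) (simple1 k)"
      by (auto simp: LinearCombinations.module_hom_def N_def simple1_def f_g g_smult
          simp flip: g_add)
  qed
  ultimately show ?thesis
    unfolding has_summand_iso_to_def by blast
qed

lemma simple1_summandE:
  assumes "has_summand_iso_to A M (simple1 k)"
  obtains n where "n \<in> carrier M" "n \<noteq> \<zero>\<^bsub>M\<^esub>" "e1 \<odot>\<^bsub>M\<^esub> n = n"
    "\<And>\<alpha>. \<alpha> \<in> {..<r} \<rightarrow>\<^sub>E carrier k \<Longrightarrow> xe \<alpha> \<odot>\<^bsub>M\<^esub> n = \<zero>\<^bsub>M\<^esub>"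
proof -
  obtain N f where N: "left_submodule A N M"
    and f: "f \<in> LinearCombinations.module_hom A (M\<lparr>carrier := N\<rparr>) (simple1 k)"
    and bij: "bij_betw f N (carrier k)"
    using assms unfolding has_summand_iso_to_def module_iso_def by (auto simp: simple1_def)
  have NM: "N \<subseteq> carrier M" and N_smult: "\<And>a v. \<lbrakk>a \<in> carrier A; v \<in> N\<rbrakk> \<Longrightarrow> a \<odot>\<^bsub>M\<^esub> v \<in> N"
    and N_zero: "\<zero>\<^bsub>M\<^esub> \<in> N"
    using N by (auto simp: left_submodule_def)
  have f_smult: "f (a \<odot>\<^bsub>M\<^esub> v) = a Triv1 \<otimes>\<^bsub>k\<^esub> f v" if "a \<in> carrier A" "v \<in> N" for a v
    using LinearCombinations.module_hom_smult[OF f that(1)] that(2) by (simp add: simple1_def)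
  have f_inj: "v = w" if "f v = f w" "v \<in> N" "w \<in> N" for v w
    using that bij by (auto simp: bij_betw_def inj_on_def)
  obtain n where n: "n \<in> N" "f n = \<one>\<^bsub>k\<^esub>"
    using bij K.one_closed by (metis bij_betw_imp_surj_on imageE)
  have "f (\<zero>\<^bsub>A\<^esub> \<odot>\<^bsub>M\<^esub> n) = \<zero>\<^bsub>k\<^esub>"
    using n f_smult[of "\<zero>\<^bsub>A\<^esub>" n] by simp
  moreover have nM: "n \<in> carrier M"
    using n NM by auto
  ultimately have f_zero: "f \<zero>\<^bsub>M\<^esub> = \<zero>\<^bsub>k\<^esub>"
    by simp
  show ?thesis
  proof
    show "n \<in> carrier M"
      by (rule nM)
    show "n \<noteq> \<zero>\<^bsub>M\<^esub>"
      using n f_zero by auto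
    show "e1 \<odot>\<^bsub>M\<^esub> n = n"
      using n f_smult[of e1 n] by (intro f_inj N_smult) auto
    show "xe \<alpha> \<odot>\<^bsub>M\<^esub> n = \<zero>\<^bsub>M\<^esub>" if "\<alpha> \<in> {..<r} \<rightarrow>\<^sub>E carrier k" for \<alpha>
      using n f_smult[of "xe \<alpha>" n] f_zero that N_zero by (intro f_inj N_smult) auto
  qed
qed

text \<open>A generator \<open>n\<close> of such a summand lies in every socle and is fixed by
  \<open>e1\<close>, whereas vanishing homomorphisms force \<open>e1 n\<close> to be zero.\<close>

lemma no_simple1_summand:
  assumes "d < r"
    and zero: "\<And>U. U \<in> grassmannian k d r \<Longrightarrow>
      carrier (hom_space A (X_mod k r d U) M) = {\<zero>\<^bsub>hom_space A (X_mod k r d U) M\<^esub>}"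
  shows "\<not> has_summand_iso_to A M (simple1 k)"
proof
  assume "has_summand_iso_to A M (simple1 k)"
  then obtain n where n: "n \<in> carrier M" "n \<noteq> \<zero>\<^bsub>M\<^esub>" "e1 \<odot>\<^bsub>M\<^esub> n = n"
    "\<And>\<alpha>. \<alpha> \<in> {..<r} \<rightarrow>\<^sub>E carrier k \<Longrightarrow> xe \<alpha> \<odot>\<^bsub>M\<^esub> n = \<zero>\<^bsub>M\<^esub>"
    by (rule simple1_summandE) blast
  \<comment> \<open>The Grassmannian is nonempty: the first \<open>d\<close> coordinates span a
    point of it.\<close>
  obtain U where U: "U \<in> grassmannian k d r"
    using K.coordinate_subspace_grassmannian[of "{..<d}" r] \<open>d < r\<close> by auto
  have "n \<in> Soc k r U M"
    using n grassmannian_carrier[OF U] by (auto simp: Soc_def)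
  then show False
    using n Soc_eq_if_hom_zero[OF U zero[OF U]] by auto
qed

text \<open>A socle element \<open>m\<close> with \<open>e1 m\<close> nonzero would make
  \<open>e1 m\<close> span a summand isomorphic to \<open>simple1 k\<close>.\<close>

lemma hom_zero_if_equal_socles:
  assumes fd: "V.fin_dim" and d: "1 \<le> d" "d < r"
    and ESP: "\<And>U V. \<lbrakk>U \<in> grassmannian k d r; V \<in> grassmannian k d r\<rbrakk> \<Longrightarrow> Soc k r U M = Soc k r V M"
    and summand: "\<not> has_summand_iso_to A M (simple1 k)"
    and U: "U \<in> grassmannian k d r"
  shows "carrier (hom_space A (X_mod k r d U) M) = {\<zero>\<^bsub>hom_space A (X_mod k r d U) M\<^esub>}"
proof -
  interpret F: kronecker_module_family k r M d U "SOME u. is_basis_family k r d U u"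
    by (rule X_mod_family[OF U])
  have "e1 \<odot>\<^bsub>M\<^esub> m = \<zero>\<^bsub>M\<^esub>" if m: "m \<in> Soc k r U M" for m
  proof (rule ccontr)
    let ?n = "e1 \<odot>\<^bsub>M\<^esub> m"
    assume n0: "?n \<noteq> \<zero>\<^bsub>M\<^esub>"
    have mM: "m \<in> carrier M"
      using m by (simp add: Soc_def)
    have "xe (unit_vector k r i) \<odot>\<^bsub>M\<^esub> ?n = \<zero>\<^bsub>M\<^esub>" if "i < r" for i
    proof -
      \<comment> \<open>The socle for \<open>V\<close> is the socle for \<open>U\<close>, so
        \<open>m\<close> is killed by the unit vector lying in \<open>V\<close>.\<close>
      obtain V where V: "V \<in> grassmannian k d r" "unit_vector k r i \<in> V"
        using K.unit_vector_in_grassmannian[OF \<open>i < r\<close> d(1)] d(2) by auto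
      then have "xe (unit_vector k r i) \<odot>\<^bsub>M\<^esub> m = \<zero>\<^bsub>M\<^esub>"
        using m ESP[OF U V(1)] by (auto simp: Soc_def)
      then show ?thesis
        using mM K.unit_vector_carrier[of r i] by (simp add: x_mult_e1 flip: smult_assoc)
    qed
    then have "xe \<alpha> \<odot>\<^bsub>M\<^esub> ?n = \<zero>\<^bsub>M\<^esub>" if "\<alpha> \<in> {..<r} \<rightarrow>\<^sub>E carrier k" for \<alpha>
      using x_smult_eq_zero[OF that, of ?n] mM by simp
    moreover have "e1 \<odot>\<^bsub>M\<^esub> ?n = ?n"
      using mM e1_idem by (simp flip: smult_assoc)
    ultimately show False
      using simple1_summandI[OF fd _ n0] summand mM by auto
  qed
  then show ?thesis
    unfolding X_mod_def F.hom_zero_iff by blast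
qed

lemma dim_Soc_X_mod:
  assumes fd: "V.fin_dim" and U: "U \<in> grassmannian k d r"
  shows "vectorspace.dim k (restrict_scalars A (M\<lparr>carrier := Soc k r U M\<rparr>)) =
    vectorspace.dim k (hom_space A (X_mod k r d U) M) +
    vectorspace.dim k (restrict_scalars A (M\<lparr>carrier := {m \<in> carrier M. e1 \<odot>\<^bsub>M\<^esub> m = \<zero>\<^bsub>M\<^esub>}\<rparr>))"
  using kronecker_module_family.dim_Soc[OF X_mod_family[OF U] fd] by (simp add: X_mod_def)

end

theorem proposition2p3p3:
  fixes k :: "('k, 'b) ring_scheme" and r d :: nat
  assumes "algebraically_closed k" and "r \<ge> 2" and "1 \<le> d" and "d < r"
  shows "({M :: (kpath \<Rightarrow> 'k, 'm) module. M \<in> ESP k r d \<and>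
            \<not> has_summand_iso_to (kronecker_algebra k r) M (simple1 k)} =
         {M \<in> kronecker_mod k r. \<forall>U\<in>grassmannian k d r.
            carrier (hom_space (kronecker_algebra k r) (X_mod k r d U) M) =
              {\<zero>\<^bsub>hom_space (kronecker_algebra k r) (X_mod k r d U) M\<^esub>}}) \<and>
         ((CSR k r d :: (kpath \<Rightarrow> 'k, 'm) module set) =
         {M \<in> kronecker_mod k r. \<exists>c :: nat. \<forall>U\<in>grassmannian k d r.
            vectorspace.dim k (hom_space (kronecker_algebra k r) (X_mod k r d U) M) = c})"
proof -
  have field: "field k"
    using assms(1) by (simp add: algebraically_closed_def)
  have esp: "M \<in> ESP k r d \<and> \<not> has_summand_iso_to (kronecker_algebra k r) M (simple1 k) \<longleftrightarrow>
      (\<forall>U\<in>grassmannian k d r. carrier (hom_space (kronecker_algebra k r) (X_mod k r d U) M) =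
        {\<zero>\<^bsub>hom_space (kronecker_algebra k r) (X_mod k r d U) M\<^esub>})"
    and csr: "M \<in> CSR k r d \<longleftrightarrow> (\<exists>c :: nat. \<forall>U\<in>grassmannian k d r.
        vectorspace.dim k (hom_space (kronecker_algebra k r) (X_mod k r d U) M) = c)"
    if M: "M \<in> kronecker_mod k r" for M :: "(kpath \<Rightarrow> 'k, 'm) module"
  proof -
    interpret kronecker_module k r M
      using M field by (simp add: kronecker_mod_def kronecker_module_def)
    have fd: "V.fin_dim"
      using M by (simp add: kronecker_mod_def)
    let ?hom_zero = "\<lambda>U. carrier (hom_space A (X_mod k r d U) M) =
      {\<zero>\<^bsub>hom_space A (X_mod k r d U) M\<^esub>}"
    show "M \<in> ESP k r d \<and> \<not> has_summand_iso_to A M (simple1 k) \<longleftrightarrow>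
        (\<forall>U\<in>grassmannian k d r. ?hom_zero U)"
    proof
      assume *: "M \<in> ESP k r d \<and> \<not> has_summand_iso_to A M (simple1 k)"
      then have "Soc k r U M = Soc k r V M"
        if "U \<in> grassmannian k d r" "V \<in> grassmannian k d r" for U V
        using that unfolding ESP_def by blast
      then show "\<forall>U\<in>grassmannian k d r. ?hom_zero U"
        using hom_zero_if_equal_socles[OF fd assms(3,4)] * by blast
    next
      assume *: "\<forall>U\<in>grassmannian k d r. ?hom_zero U"
      then have "Soc k r U M = {m \<in> carrier M. e1 \<odot>\<^bsub>M\<^esub> m = \<zero>\<^bsub>M\<^esub>}"
        if "U \<in> grassmannian k d r" for U
        using that by (intro Soc_eq_if_hom_zero) auto
      then have "M \<in> ESP k r d"
        using M by (simp add: ESP_def)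
      moreover have "\<not> has_summand_iso_to A M (simple1 k)"
        using * by (intro no_simple1_summand[OF assms(4)]) blast
      ultimately show "M \<in> ESP k r d \<and> \<not> has_summand_iso_to A M (simple1 k)" ..
    qed
    let ?h = "\<lambda>U. vectorspace.dim k (hom_space A (X_mod k r d U) M)"
    \<comment> \<open>The dimension of \<open>M\<^sub>2\<close> is a summand on both sides and
      cancels.\<close>
    have "M \<in> CSR k r d \<longleftrightarrow>
        (\<forall>U\<in>grassmannian k d r. \<forall>V\<in>grassmannian k d r. ?h U = ?h V)"
      using M dim_Soc_X_mod[OF fd, of _ d] by (simp add: CSR_def)
    then show "M \<in> CSR k r d \<longleftrightarrow> (\<exists>c. \<forall>U\<in>grassmannian k d r. ?h U = c)"
      by metis
  qed
  \<comment> \<open>All four sets consist of finite-dimensional modules, so the two equivalences for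
    such \<open>M\<close> suffice.\<close>
  have "M \<in> kronecker_mod k r" if "M \<in> ESP k r d \<or> M \<in> CSR k r d"
    for M :: "(kpath \<Rightarrow> 'k, 'm) module"
    using that by (auto simp: ESP_def CSR_def)
  then show ?thesis
    using esp csr by blast
qed

end
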